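(* Let $G$ be the group of one of Constructions B, C, D in the context, let $p^e$ be the order of $g$ (so $p^e=p$ for Constructions B and C and $p^e=9$ for Construction D), and assume $l>1$. Then the nilpotency class of $G$ lies in the interval $[2p^e,3p^e]$.
   Context: Pairs $(A,\sigma)$, $A\in\mathrm{GL}(4,q)$, $\sigma\in\mathrm{Aut}(\mathbb{F}_q)$, multiply by $(A_1,\sigma_1)\circ(A_2,\sigma_2)=(A_1^{\sigma_2}A_2,\sigma_1\sigma_2)$ ($A^\sigma$: $\sigma$ applied entrywise). $E(a,b,c,t)$ is the matrix with rows $(1,0,0,0),(-c,1,0,0),(b-ct,t,1,0),(a,b,c,1)$. Given $T,\theta$ put $\mathfrak{g}_{a,b,c}=(E(a,b,c,T(a,b,c)),\theta_{a,b,c})$. $\mathrm{tr}=\mathrm{tr}_{\mathbb{F}_q/\mathbb{F}_p}$. Construction B: $q=p^{pl}$, $p$ odd, $g(x)=x^{p^l}$; $S_1$ a reduced linearized polynomial with coefficients in $\mathbb{F}_{p^l}$; $\mu_C\in\mathbb{F}_{p^l}^*$; $\theta_{a,b,c}=g^{\mathrm{tr}(\mu_Cc)}$, $T(a,b,c)=S_1(c)$; $G=\{\mathfrak{g}_{a,b,c}:a,b,c\in\mathbb{F}_q\}$. Construction C: $q=p^{pl}$, $p$ odd, $g(x)=x^{p^l}$; $\mu_B\in\mathbb{F}_{p^l}^*$; $s_i\in\mathbb{F}_{p^l}$ ($0\le i\le pl-1$) with $\mu_Bs_i-s_{pl-i}^{p^i}\mu_B^{p^i}=0$ for $1\le i\le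 pl-1$; $S_1=\sum s_iX^{p^i}$, $Q(x)=-\mathrm{tr}(\mu_BxS_1(x))$; $\theta_{a,b,c}=g^{\frac12Q(c)+\mathrm{tr}(\mu_Bb)}$, $T(a,b,c)=S_1(c)$; $G=\{\mathfrak{g}_{a,b,c}\}$. Construction D: $p=3$, $q=3^{9l}$, $g(x)=x^{3^l}$, $g_1=g^3$; $u\in\mathbb{F}_{3^{3l}}$ with $\mu_C=u-u^g\in\mathbb{F}_{3^l}^*$; $t_C$ with $\lambda_C=\mathrm{tr}_{\mathbb{F}_q/\mathbb{F}_3}(\mu_Ct_C)\ne0$; $\mu_B\in\mathbb{F}_{3^l}^*$; $s_i\in\mathbb{F}_{3^l}$ with $-\mu_Bs_i+s_{9l-i}^{3^i}\mu_B^{3^i}=\mu_Cu^{3^i}-u\mu_C^{3^i}$, $1\le i\le 9l-1$; $\alpha\in\mathbb{F}_{3^{3l}}$, $\lambda\in\mathbb{F}_3$ with $g(\alpha)-\alpha=\lambda_Cu+\lambda\mu_C$; $S_1=\sum s_iX^{3^i}$, $Q(x)=-\mathrm{tr}_{\mathbb{F}_q/\mathbb{F}_3}(\mu_BxS_1(x))$, $K=\{z:\mathrm{tr}_{\mathbb{F}_q/\mathbb{F}_3}(\mu_Cz)=0\}$; for $a,b\in\mathbb{F}_q$, $c\in K$, $\mathfrak{g}_{a,b,c}=(E(a,b,c,S_1(c)),g_1^{\frac12Q(c)+\mathrm{tr}_{\mathbb{F}_q/\mathbb{F}_3}(\alpha c+\mu_Bb)})$; $G=\langle\{\mathfrak{g}_{a,b,c}:a,b\in\mathbb{F}_q,c\in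 K\},(E(0,0,t_C,S_1(t_C)),g)\rangle$. *)

theory Defs
  imports "HOL-Analysis.Analysis" "HOL-Algebra.Generated_Groups" "HOL-Algebra.Multiplicative_Group"
    "HOL-Computational_Algebra.Polynomial" "HOL-Computational_Algebra.Primes"
begin

definition commutator_subgroup :: "('g, 'm) monoid_scheme \<Rightarrow> 'g set \<Rightarrow> 'g set \<Rightarrow> 'g set" where
  "commutator_subgroup G H K =
     generate G {h \<otimes>\<^bsub>G\<^esub> k \<otimes>\<^bsub>G\<^esub> inv\<^bsub>G\<^esub> h \<otimes>\<^bsub>G\<^esub> inv\<^bsub>G\<^esub> k | h k. h \<in> H \<and> k \<in> K}"

text \<open>The series is indexed from 0, so that the nilpotency class is the least index at which it
  becomes trivial.\<close>

primrec lower_central_series :: "('g, 'm) monoid_scheme \<Rightarrow> nat \<Rightarrow> 'g set" where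
  "lower_central_series G 0 = carrier G"
| "lower_central_series G (Suc n) = commutator_subgroup G (lower_central_series G n) (carrier G)"

definition nilpotent_group :: "('g, 'm) monoid_scheme \<Rightarrow> bool" where
  "nilpotent_group G \<longleftrightarrow> group G \<and> (\<exists>n. lower_central_series G n = {\<one>\<^bsub>G\<^esub>})"

definition nilpotency_class :: "('g, 'm) monoid_scheme \<Rightarrow> nat" where
  "nilpotency_class G = (LEAST n. lower_central_series G n = {\<one>\<^bsub>G\<^esub>})"


definition field_auts :: "('a::field \<Rightarrow> 'a) set" where
  "field_auts = {\<sigma>. bij \<sigma> \<and> (\<forall>x y. \<sigma> (x + y) = \<sigma> x + \<sigma> y) \<and> (\<forall>x y. \<sigma> (x * y) = \<sigma> x * \<sigma> y)}"

text \<open>Automorphisms act from the right, so \<open>\<sigma>\<tau>\<close> means: first \<open>\<sigma>\<close>, then \<open>\<tau>\<close>. (For a finite field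
  the order is immaterial.)\<close>

definition Aut_field :: "('a::field \<Rightarrow> 'a) monoid" where
  "Aut_field = \<lparr>carrier = field_auts, mult = (\<lambda>\<sigma> \<tau>. \<tau> \<circ> \<sigma>), one = id\<rparr>"

type_synonym 'a semilin = "('a^4^4) \<times> ('a \<Rightarrow> 'a)"

definition GammaL4 :: "('a::field) semilin monoid" where
  "GammaL4 = \<lparr>carrier = {A. invertible A} \<times> field_auts,
     mult = (\<lambda>(A\<^sub>1, \<sigma>\<^sub>1) (A\<^sub>2, \<sigma>\<^sub>2). (map_matrix \<sigma>\<^sub>2 A\<^sub>1 ** A\<^sub>2, \<sigma>\<^sub>1 \<otimes>\<^bsub>Aut_field\<^esub> \<sigma>\<^sub>2)),
     one = (mat 1, id)\<rparr>"

definition E_mat :: "'a::field \<Rightarrow> 'a \<Rightarrow> 'a \<Rightarrow> 'a \<Rightarrow> 'a^4^4" where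
  "E_mat a b c t = vector
     [vector [1, 0, 0, 0],
      vector [- c, 1, 0, 0],
      vector [b - c * t, t, 1, 0],
      vector [a, b, c, 1]]"


text \<open>The subfield with \<open>n\<close> elements of a finite field, for \<open>n\<close> an order of a subfield.\<close>

definition subfield_of_order :: "nat \<Rightarrow> 'a::field set" where
  "subfield_of_order n = {x. x ^ n = x}"

text \<open>The trace from the field with \<open>p ^ n\<close> elements to its prime field, which is regarded as a
  subset of the big field.\<close>

definition abs_trace :: "nat \<Rightarrow> nat \<Rightarrow> 'a::field \<Rightarrow> 'a" where
  "abs_trace p n x = (\<Sum>i<n. x ^ (p ^ i))"

text \<open>\<open>f\<close> to the power \<open>x\<close>, for \<open>x\<close> in the prime field; used only for \<open>f\<close> of order the
  characteristic, so that the choice of the representative of \<open>x\<close> is immaterial.\<close>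

definition prime_field_pow :: "('a \<Rightarrow> 'a) \<Rightarrow> 'a::field \<Rightarrow> ('a \<Rightarrow> 'a)" where
  "prime_field_pow f x = f ^^ (LEAST k::nat. of_nat k = x)"

text \<open>Reduced linearized polynomials over the field with \<open>p ^ n\<close> elements.\<close>

definition lin_poly :: "nat \<Rightarrow> nat \<Rightarrow> (nat \<Rightarrow> 'a::field) \<Rightarrow> 'a poly" where
  "lin_poly p n s = (\<Sum>i<n. Polynomial.monom (s i) (p ^ i))"

definition reduced_linearized :: "nat \<Rightarrow> nat \<Rightarrow> 'a::field poly \<Rightarrow> bool" where
  "reduced_linearized p n S \<longleftrightarrow> (\<exists>s. S = lin_poly p n s)"


definition construction_B ::
  "nat \<Rightarrow> nat \<Rightarrow> ('a::{field,finite} \<Rightarrow> 'a) \<Rightarrow> 'a semilin monoid \<Rightarrow> bool" where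
  "construction_B p l g G \<longleftrightarrow>
     prime p \<and> odd p \<and> CARD('a) = p ^ (p * l) \<and> g = (\<lambda>x. x ^ (p ^ l)) \<and>
     (\<exists>S\<^sub>1 \<mu>\<^sub>C.
        reduced_linearized p (p * l) S\<^sub>1 \<and>
        (\<forall>i. Polynomial.coeff S\<^sub>1 i \<in> subfield_of_order (p ^ l)) \<and>
        \<mu>\<^sub>C \<in> subfield_of_order (p ^ l) - {0} \<and>
        G = GammaL4\<lparr>carrier :=
              {(E_mat a b c (poly S\<^sub>1 c), prime_field_pow g (abs_trace p (p * l) (\<mu>\<^sub>C * c))) | a b c. True}\<rparr>)"

definition construction_C ::
  "nat \<Rightarrow> nat \<Rightarrow> ('a::{field,finite} \<Rightarrow> 'a) \<Rightarrow> 'a semilin monoid \<Rightarrow> bool" where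
  "construction_C p l g G \<longleftrightarrow>
     prime p \<and> odd p \<and> CARD('a) = p ^ (p * l) \<and> g = (\<lambda>x. x ^ (p ^ l)) \<and>
     (\<exists>\<mu>\<^sub>B s S\<^sub>1 Q.
        \<mu>\<^sub>B \<in> subfield_of_order (p ^ l) - {0} \<and>
        (\<forall>i<p * l. s i \<in> subfield_of_order (p ^ l)) \<and>
        (\<forall>i\<in>{1..p * l - 1}. \<mu>\<^sub>B * s i - s (p * l - i) ^ (p ^ i) * \<mu>\<^sub>B ^ (p ^ i) = 0) \<and>
        S\<^sub>1 = lin_poly p (p * l) s \<and>
        Q = (\<lambda>x. - abs_trace p (p * l) (\<mu>\<^sub>B * x * poly S\<^sub>1 x)) \<and>
        G = GammaL4\<lparr>carrier :=
              {(E_mat a b c (poly S\<^sub>1 c),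
                prime_field_pow g (1 / 2 * Q c + abs_trace p (p * l) (\<mu>\<^sub>B * b))) | a b c. True}\<rparr>)"

definition construction_D ::
  "nat \<Rightarrow> ('a::{field,finite} \<Rightarrow> 'a) \<Rightarrow> 'a semilin monoid \<Rightarrow> bool" where
  "construction_D l g G \<longleftrightarrow>
     CARD('a) = 3 ^ (9 * l) \<and> g = (\<lambda>x. x ^ (3 ^ l)) \<and>
     (\<exists>u \<mu>\<^sub>C t\<^sub>C lam\<^sub>C \<mu>\<^sub>B s \<alpha> lam S\<^sub>1 Q K.
        u \<in> subfield_of_order (3 ^ (3 * l)) \<and>
        \<mu>\<^sub>C = u - g u \<and> \<mu>\<^sub>C \<in> subfield_of_order (3 ^ l) - {0} \<and>
        lam\<^sub>C = abs_trace 3 (9 * l) (\<mu>\<^sub>C * t\<^sub>C) \<and> lam\<^sub>C \<noteq> 0 \<and>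
        \<mu>\<^sub>B \<in> subfield_of_order (3 ^ l) - {0} \<and>
        (\<forall>i<9 * l. s i \<in> subfield_of_order (3 ^ l)) \<and>
        (\<forall>i\<in>{1..9 * l - 1}.
           - \<mu>\<^sub>B * s i + s (9 * l - i) ^ (3 ^ i) * \<mu>\<^sub>B ^ (3 ^ i) = \<mu>\<^sub>C * u ^ (3 ^ i) - u * \<mu>\<^sub>C ^ (3 ^ i)) \<and>
        \<alpha> \<in> subfield_of_order (3 ^ (3 * l)) \<and> lam \<in> subfield_of_order 3 \<and>
        g \<alpha> - \<alpha> = lam\<^sub>C * u + lam * \<mu>\<^sub>C \<and>
        S\<^sub>1 = lin_poly 3 (9 * l) s \<and>
        Q = (\<lambda>x. - abs_trace 3 (9 * l) (\<mu>\<^sub>B * x * poly S\<^sub>1 x)) \<and>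
        K = {z. abs_trace 3 (9 * l) (\<mu>\<^sub>C * z) = 0} \<and>
        G = GammaL4\<lparr>carrier := generate GammaL4
              ({(E_mat a b c (poly S\<^sub>1 c),
                 prime_field_pow (g ^^ 3) (1 / 2 * Q c + abs_trace 3 (9 * l) (\<alpha> * c + \<mu>\<^sub>B * b)))
                | a b c. c \<in> K}
               \<union> {(E_mat 0 0 t\<^sub>C (poly S\<^sub>1 t\<^sub>C), g)})\<rparr>)"

end

theory Submission
  imports Defs "HOL-Number_Theory.Residues"
begin

text \<open>
  Write \<open>m = p ^ e\<close> for the order of \<open>g\<close>. All three groups lie in the semidirect product of the group
  of matrices \<open>E(a, b, c, t)\<close> with the cyclic group generated by \<open>g\<close>. The matrix group has the three
  abelian layers \<open>(c, t)\<close>, \<open>b\<close>, \<open>a\<close>, on each of which matrices act trivially and \<open>(1 - g) ^ m =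
  1 - g ^ m = 0\<close>; hence the lower central series drops through each layer in at most \<open>m\<close> steps, and
  the class is at most \<open>3m\<close>.

  For the lower bound, each group contains all elements \<open>(E(a, b, 0, 0), 1)\<close> with \<open>tr (\<mu> b) = 0\<close>, for
  some nonzero \<open>\<mu>\<close> fixed by \<open>g\<close>, and an element \<open>h = (E(\<dots>, c\<^sub>0, \<dots>), g)\<close> such that \<open>d = Tr c\<^sub>0 \<noteq> 0\<close>,
  where \<open>Tr\<close> is the trace to the fixed field of \<open>g\<close>. Commutation with \<open>h\<close> is the linear map
  \<open>1 - \<phi>\<close> on pairs \<open>(a, b)\<close>, where \<open>\<phi>\<close> is conjugation by \<open>h\<close>. In characteristic \<open>p\<close> we have
  \<open>(1 - \<phi>) ^ m = 1 - \<phi> ^ m\<close> and \<open>(1 - \<phi>) ^ (m - 1) = 1 + \<phi> + \<dots> + \<phi> ^ (m - 1)\<close>, so that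
  \<open>(1 - \<phi>) ^ (2m - 1)\<close> maps \<open>(0, b)\<close> to \<open>(- 2 d Tr b, 0)\<close>. Since \<open>l > 1\<close>, the kernel of \<open>tr (\<mu> _)\<close> is too
  large to be contained in the kernel of \<open>Tr\<close>, and thus the class is at least \<open>2m\<close>.
\<close>

section \<open>Lower central series and semilinear maps\<close>

text \<open>Left multiplication by an element of the finite set \<open>H\<close> is injective, hence
  a permutation of \<open>H\<close>, and so produces the unit and inverses.\<close>

lemma (in group) subgroupI_finite:
  assumes "H \<subseteq> carrier G" "finite H" "H \<noteq> {}"
    and closed: "\<And>x y. x \<in> H \<Longrightarrow> y \<in> H \<Longrightarrow> x \<otimes> y \<in> H"
  shows "subgroup H G"
proof (rule subgroupI)
  fix a assume a: "a \<in> H"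
  have "inj_on ((\<otimes>) a) H"
    using assms(1) a by (meson inj_on_cmult inj_on_subset subsetD)
  moreover have "(\<otimes>) a ` H \<subseteq> H"
    using closed a by blast
  ultimately have onto: "(\<otimes>) a ` H = H"
    using assms(2) by (simp add: endo_inj_surj)
  then obtain x where x: "x \<in> H" "a = a \<otimes> x"
    using a by (metis imageE)
  then have "x = \<one>"
    using assms(1) a by (simp add: subset_iff)
  with x have "\<one> \<in> H"
    by simp
  then obtain y where "y \<in> H" "\<one> = a \<otimes> y"
    using onto by (metis imageE)
  moreover from this have "inv a = y"
    using assms(1) a by (metis inv_char inv_comm subsetD)
  ultimately show "inv a \<in> H"
    by simp
qed (use assms in auto)

text \<open>Commutators are handled through the inverse-free equation y h x = x h, because products
  in \<open>GammaL4\<close> are explicit whereas inverses are clumsy.\<close>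

lemma (in group) commutator_eqI:
  assumes "x \<in> carrier G" "h \<in> carrier G" "y \<in> carrier G" "y \<otimes> h \<otimes> x = x \<otimes> h"
  shows "x \<otimes> h \<otimes> inv x \<otimes> inv h = y"
  unfolding assms(4)[symmetric] using assms(1-3) by (simp add: m_assoc)

lemma (in group) commutator_mult:
  assumes "x \<in> carrier G" "h \<in> carrier G"
  shows "(x \<otimes> h \<otimes> inv x \<otimes> inv h) \<otimes> h \<otimes> x = x \<otimes> h"
  using assms by (simp add: m_assoc)

context group
begin

lemma subgroup_lower_central_series:
  assumes "subgroup H G"
  shows "subgroup (lower_central_series (G\<lparr>carrier := H\<rparr>) n) (G\<lparr>carrier := H\<rparr>)"
proof -
  interpret H: group "G\<lparr>carrier := H\<rparr>"
    using assms by (rule subgroup_imp_group)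
  show ?thesis
  proof (induction n)
    case 0
    show ?case using H.subgroup_self by simp
  next
    case (Suc n)
    then have sub: "lower_central_series (G\<lparr>carrier := H\<rparr>) n \<subseteq> carrier (G\<lparr>carrier := H\<rparr>)"
      by (rule subgroup.subset)
    show ?case
      unfolding lower_central_series.simps commutator_subgroup_def
      by (rule H.generate_is_subgroup) (use sub in \<open>blast intro: H.m_closed H.inv_closed\<close>)
  qed
qed

text \<open>The tool for the upper bound. The \<open>N k\<close> are subgroups of the ambient group,
  so that one chain serves all three constructions.\<close>

lemma lower_central_series_subset:
  assumes H: "subgroup H G" and N: "\<And>k. subgroup (N k) G" and "H \<subseteq> N 0"
    and comm: "\<And>k x h. x \<in> N k \<Longrightarrow> h \<in> H \<Longrightarrow> x \<otimes> h \<otimes> inv x \<otimes> inv h \<in> N (Suc k)"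
  shows "lower_central_series (G\<lparr>carrier := H\<rparr>) n \<subseteq> N n"
proof (induction n)
  case 0
  show ?case using assms(3) by simp
next
  case (Suc n)
  have sub: "lower_central_series (G\<lparr>carrier := H\<rparr>) n \<subseteq> H"
    using subgroup.subset[OF subgroup_lower_central_series[OF H]] by simp
  define C where "C = {x \<otimes>\<^bsub>G\<lparr>carrier := H\<rparr>\<^esub> h \<otimes>\<^bsub>G\<lparr>carrier := H\<rparr>\<^esub> inv\<^bsub>G\<lparr>carrier := H\<rparr>\<^esub> x
      \<otimes>\<^bsub>G\<lparr>carrier := H\<rparr>\<^esub> inv\<^bsub>G\<lparr>carrier := H\<rparr>\<^esub> h | x h.
      x \<in> lower_central_series (G\<lparr>carrier := H\<rparr>) n \<and> h \<in> carrier (G\<lparr>carrier := H\<rparr>)}"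
  have C: "y \<in> H \<and> y \<in> N (Suc n)" if yC: "y \<in> C" for y
  proof -
    obtain x h where x: "x \<in> lower_central_series (G\<lparr>carrier := H\<rparr>) n" and h: "h \<in> H"
      and y: "y = x \<otimes> h \<otimes> inv\<^bsub>G\<lparr>carrier := H\<rparr>\<^esub> x \<otimes> inv\<^bsub>G\<lparr>carrier := H\<rparr>\<^esub> h"
      using yC unfolding C_def by auto
    have "x \<in> H"
      using x sub by blast
    then have "y = x \<otimes> h \<otimes> inv x \<otimes> inv h"
      using y h H by simp
    moreover have "x \<otimes> h \<otimes> inv x \<otimes> inv h \<in> H"
      using H h \<open>x \<in> H\<close> by (intro subgroup.m_closed[OF H] subgroup.m_inv_closed[OF H])
    moreover have "x \<otimes> h \<otimes> inv x \<otimes> inv h \<in> N (Suc n)"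
      using Suc x h by (intro comm) auto
    ultimately show ?thesis
      by simp
  qed
  then have "generate (G\<lparr>carrier := H\<rparr>) C = generate G C"
    using H by (intro generate_consistent) auto
  moreover have "generate G C \<subseteq> N (Suc n)"
    using C by (intro generate_subgroup_incl[OF _ N]) auto
  ultimately show ?case
    by (simp only: lower_central_series.simps commutator_subgroup_def flip: C_def)
qed

text \<open>The tool for the lower bound: explicit elements are followed down the series by repeated
  commutation.\<close>

lemma commutator_in_lower_central_series:
  assumes H: "subgroup H G" and x: "x \<in> lower_central_series (G\<lparr>carrier := H\<rparr>) n"
    and "h \<in> H" "y \<in> H" "y \<otimes> h \<otimes> x = x \<otimes> h"
  shows "y \<in> lower_central_series (G\<lparr>carrier := H\<rparr>) (Suc n)"
proof -
  interpret H: group "G\<lparr>carrier := H\<rparr>"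
    using H by (rule subgroup_imp_group)
  have "x \<in> H"
    using subgroup.subset[OF subgroup_lower_central_series[OF H]] x by fastforce
  then have "y = x \<otimes>\<^bsub>G\<lparr>carrier := H\<rparr>\<^esub> h \<otimes>\<^bsub>G\<lparr>carrier := H\<rparr>\<^esub> inv\<^bsub>G\<lparr>carrier := H\<rparr>\<^esub> x \<otimes>\<^bsub>G\<lparr>carrier := H\<rparr>\<^esub>
      inv\<^bsub>G\<lparr>carrier := H\<rparr>\<^esub> h"
    using assms by (intro H.commutator_eqI[symmetric]) auto
  then show ?thesis
    unfolding lower_central_series.simps commutator_subgroup_def
    using x \<open>h \<in> H\<close> by (intro generate.incl) auto
qed

end

section \<open>Field automorphisms and the group of semilinear pairs\<close>

lemma field_auts_add: "\<sigma> \<in> field_auts \<Longrightarrow> \<sigma> (x + y) = \<sigma> x + \<sigma> y"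
  and field_auts_mult: "\<sigma> \<in> field_auts \<Longrightarrow> \<sigma> (x * y) = \<sigma> x * \<sigma> y"
  and field_auts_bij: "\<sigma> \<in> field_auts \<Longrightarrow> bij \<sigma>"
  by (auto simp: field_auts_def)

lemma field_auts_0: "\<sigma> \<in> field_auts \<Longrightarrow> \<sigma> 0 = 0"
  using field_auts_add[of \<sigma> 0 0] by (metis add_cancel_right_right)

lemma field_auts_1:
  assumes "\<sigma> \<in> field_auts"
  shows "\<sigma> 1 = 1"
proof -
  have "\<sigma> 1 \<noteq> \<sigma> 0"
    using field_auts_bij[OF assms] by (simp add: bij_is_inj inj_eq)
  then show ?thesis
    using field_auts_mult[OF assms, of 1 1] field_auts_0[OF assms] by simp
qed

lemma field_auts_minus: "\<sigma> \<in> field_auts \<Longrightarrow> \<sigma> (- x) = - \<sigma> x"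
  using field_auts_add[of \<sigma> x "- x"] field_auts_0[of \<sigma>]
  by (simp add: eq_neg_iff_add_eq_0 add.commute)

lemma field_auts_diff: "\<sigma> \<in> field_auts \<Longrightarrow> \<sigma> (x - y) = \<sigma> x - \<sigma> y"
  using field_auts_add[of \<sigma> x "- y"] by (simp add: field_auts_minus)

lemma field_auts_sum: "\<sigma> \<in> field_auts \<Longrightarrow> \<sigma> (sum f A) = (\<Sum>x\<in>A. \<sigma> (f x))"
  by (induction A rule: infinite_finite_induct) (auto simp: field_auts_0 field_auts_add)

lemmas field_auts_hom =
  field_auts_add field_auts_mult field_auts_0 field_auts_1 field_auts_minus field_auts_diff

lemma id_in_field_auts: "id \<in> field_auts"
  by (simp add: field_auts_def)

lemma comp_in_field_auts: "\<sigma> \<in> field_auts \<Longrightarrow> \<tau> \<in> field_auts \<Longrightarrow> \<sigma> \<circ> \<tau> \<in> field_auts"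
  by (auto simp: field_auts_def intro: bij_comp)

lemma inv_in_field_auts:
  assumes "\<sigma> \<in> field_auts"
  shows "inv_into UNIV \<sigma> \<in> field_auts"
proof -
  have s: "\<sigma> (inv_into UNIV \<sigma> x) = x" for x
    using assms by (simp add: field_auts_bij bij_is_surj surj_f_inv_f)
  have i: "inj \<sigma>"
    using assms by (simp add: field_auts_bij bij_is_inj)
  have "inv_into UNIV \<sigma> (x + y) = inv_into UNIV \<sigma> x + inv_into UNIV \<sigma> y" for x y
    by (rule injD[OF i]) (simp add: s field_auts_add[OF assms])
  moreover have "inv_into UNIV \<sigma> (x * y) = inv_into UNIV \<sigma> x * inv_into UNIV \<sigma> y" for x y
    by (rule injD[OF i]) (simp add: s field_auts_mult[OF assms])
  ultimately show ?thesis
    using assms by (simp add: field_auts_def bij_imp_bij_inv)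
qed

lemma group_Aut_field: "group (Aut_field :: ('a::field \<Rightarrow> 'a) monoid)"
proof (rule groupI)
  fix \<sigma> :: "'a \<Rightarrow> 'a" assume "\<sigma> \<in> carrier Aut_field"
  then show "\<exists>\<tau>\<in>carrier Aut_field. \<tau> \<otimes>\<^bsub>Aut_field\<^esub> \<sigma> = \<one>\<^bsub>Aut_field\<^esub>"
    by (intro bexI[of _ "inv_into UNIV \<sigma>"])
      (auto simp: Aut_field_def inv_in_field_auts fun_eq_iff field_auts_bij bij_is_surj surj_f_inv_f)
qed (auto simp: Aut_field_def id_in_field_auts comp_in_field_auts o_assoc)

lemma map_matrix_mult:
  fixes A B :: "'a::field^'n^'n"
  assumes "\<sigma> \<in> field_auts"
  shows "map_matrix \<sigma> (A ** B) = map_matrix \<sigma> A ** map_matrix \<sigma> B"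
  by (simp add: vec_eq_iff matrix_matrix_mult_def field_auts_sum field_auts_mult assms)

lemma map_matrix_one:
  assumes "\<sigma> \<in> field_auts"
  shows "map_matrix \<sigma> (mat 1 :: 'a::field^'n^'n) = mat 1"
  by (simp add: vec_eq_iff mat_def field_auts_0 field_auts_1 assms)

lemma invertible_map_matrix:
  fixes A :: "'a::field^'n^'n"
  assumes "\<sigma> \<in> field_auts" "invertible A"
  shows "invertible (map_matrix \<sigma> A)"
  using assms unfolding invertible_def by (metis map_matrix_mult map_matrix_one)

lemma map_matrix_comp: "map_matrix f (map_matrix g A) = map_matrix (f \<circ> g) A"
  by (simp add: vec_eq_iff)

lemma map_matrix_id: "map_matrix id A = A"
  by (simp add: vec_eq_iff)

lemma GammaL4_mult: "(A, \<sigma>) \<otimes>\<^bsub>GammaL4\<^esub> (B, \<tau>) = (map_matrix \<tau> A ** B, \<tau> \<circ> \<sigma>)"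
  by (simp add: GammaL4_def Aut_field_def)

lemma GammaL4_carrier: "(A, \<sigma>) \<in> carrier GammaL4 \<longleftrightarrow> invertible A \<and> \<sigma> \<in> field_auts"
  by (simp add: GammaL4_def)

lemma GammaL4_one: "\<one>\<^bsub>GammaL4\<^esub> = (mat 1, id)"
  by (simp add: GammaL4_def)

lemma group_GammaL4: "group (GammaL4 :: 'a::field semilin monoid)"
proof (rule groupI)
  fix x :: "'a semilin" assume "x \<in> carrier GammaL4"
  then obtain A \<sigma> where x: "x = (A, \<sigma>)" "invertible A" "\<sigma> \<in> field_auts"
    by (cases x) (auto simp: GammaL4_carrier)
  then obtain B where B: "B ** A = mat 1" "A ** B = mat 1"
    by (auto simp: invertible_def)
  define \<tau> where "\<tau> = inv_into UNIV \<sigma>"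
  have \<tau>: "\<tau> \<in> field_auts" "\<sigma> \<circ> \<tau> = id"
    using x by (auto simp: \<tau>_def inv_in_field_auts fun_eq_iff field_auts_bij bij_is_surj surj_f_inv_f)
  have "invertible B"
    using B by (auto simp: invertible_def)
  \<comment> \<open>The product applies \<open>\<sigma>\<close> to the left matrix, so
    \<open>B\<close> is first twisted by \<open>\<tau>\<close>, the inverse of
    \<open>\<sigma>\<close>.\<close>
  then show "\<exists>y\<in>carrier GammaL4. y \<otimes>\<^bsub>GammaL4\<^esub> x = \<one>\<^bsub>GammaL4\<^esub>"
    using x \<tau> B by (intro bexI[of _ "(map_matrix \<tau> B, \<tau>)"])
      (auto simp: GammaL4_mult GammaL4_carrier GammaL4_one map_matrix_comp map_matrix_id
        invertible_map_matrix)
qed (auto simp: GammaL4_mult GammaL4_carrier GammaL4_one map_matrix_comp map_matrix_mult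
    map_matrix_one invertible_map_matrix invertible_mult comp_in_field_auts id_in_field_auts
    matrix_mul_assoc o_assoc invertible_def[of "mat 1"])

section \<open>The matrices \<open>E(a, b, c, t)\<close>\<close>

lemma vector_4:
  "(vector [x, y, z, w] :: 'a::zero^4) $ 1 = x"
  "(vector [x, y, z, w] :: 'a::zero^4) $ 2 = y"
  "(vector [x, y, z, w] :: 'a::zero^4) $ 3 = z"
  "(vector [x, y, z, w] :: 'a::zero^4) $ 4 = w"
  unfolding vector_def by simp_all

lemma E_mat_nth:
  "E_mat a b c t $ 1 = vector [1, 0, 0, 0]" "E_mat a b c t $ 2 = vector [- c, 1, 0, 0]"
  "E_mat a b c t $ 3 = vector [b - c * t, t, 1, 0]" "E_mat a b c t $ 4 = vector [a, b, c, 1]"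
  by (simp_all add: E_mat_def vector_4)

text \<open>The entries \<open>c\<close> and \<open>t\<close> simply add, and every cross term in
  the entries \<open>b\<close> and \<open>a\<close> contains an entry \<open>c\<close>. This shape
  is the source of the three layers.\<close>

lemma E_mat_mult:
  "E_mat a\<^sub>1 b\<^sub>1 c\<^sub>1 t\<^sub>1 ** E_mat a\<^sub>2 b\<^sub>2 c\<^sub>2 t\<^sub>2 =
     E_mat (a\<^sub>1 + a\<^sub>2 - b\<^sub>1 * c\<^sub>2 + c\<^sub>1 * b\<^sub>2 - c\<^sub>1 * c\<^sub>2 * t\<^sub>2) (b\<^sub>1 + b\<^sub>2 + c\<^sub>1 * t\<^sub>2) (c\<^sub>1 + c\<^sub>2) (t\<^sub>1 + t\<^sub>2)"
  by (simp add: vec_eq_iff forall_4 matrix_matrix_mult_def sum_4 E_mat_nth vector_4 algebra_simps)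

lemma E_mat_eq_iff:
  "E_mat a b c t = E_mat a' b' c' t' \<longleftrightarrow> a = a' \<and> b = b' \<and> c = c' \<and> t = t'"
  by (auto simp: vec_eq_iff forall_4 E_mat_nth vector_4)

lemma E_mat_0: "E_mat 0 0 0 0 = mat 1"
  by (simp add: vec_eq_iff forall_4 E_mat_nth vector_4 mat_def)

lemma map_matrix_E_mat:
  "\<sigma> \<in> field_auts \<Longrightarrow> map_matrix \<sigma> (E_mat a b c t) = E_mat (\<sigma> a) (\<sigma> b) (\<sigma> c) (\<sigma> t)"
  by (simp add: vec_eq_iff forall_4 E_mat_nth vector_4 field_auts_hom)

lemma invertible_E_mat: "invertible (E_mat a b c t)"
proof -
  have "E_mat a b c t ** E_mat (- a) (c * t - b) (- c) (- t) = mat 1"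
       "E_mat (- a) (c * t - b) (- c) (- t) ** E_mat a b c t = mat 1"
    by (simp_all add: E_mat_mult E_mat_0[symmetric] E_mat_eq_iff algebra_simps)
  then show ?thesis
    by (auto simp: invertible_def)
qed

lemma semilin_E_mult:
  assumes "\<tau> \<in> field_auts"
  shows "(E_mat a\<^sub>1 b\<^sub>1 c\<^sub>1 t\<^sub>1, \<sigma>) \<otimes>\<^bsub>GammaL4\<^esub> (E_mat a\<^sub>2 b\<^sub>2 c\<^sub>2 t\<^sub>2, \<tau>) =
    (E_mat (\<tau> a\<^sub>1 + a\<^sub>2 - \<tau> b\<^sub>1 * c\<^sub>2 + \<tau> c\<^sub>1 * b\<^sub>2 - \<tau> c\<^sub>1 * c\<^sub>2 * t\<^sub>2) (\<tau> b\<^sub>1 + b\<^sub>2 + \<tau> c\<^sub>1 * t\<^sub>2)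
       (\<tau> c\<^sub>1 + c\<^sub>2) (\<tau> t\<^sub>1 + t\<^sub>2), \<tau> \<circ> \<sigma>)"
  using assms by (simp add: GammaL4_mult map_matrix_E_mat E_mat_mult)

section \<open>Finite fields and the Frobenius automorphism\<close>

lemma coeff_one_minus_X_power_Suc:
  "Polynomial.coeff ([:1, - 1 :: 'a::comm_ring_1:] ^ Suc n) 0 = Polynomial.coeff ([:1, - 1:] ^ n) 0"
  "Polynomial.coeff ([:1, - 1 :: 'a:] ^ Suc n) (Suc k) =
     Polynomial.coeff ([:1, - 1:] ^ n) (Suc k) - Polynomial.coeff ([:1, - 1:] ^ n) k"
  by simp_all

text \<open>Binomial expansion of \<open>(1 - f) ^ n\<close>, with coefficients read off the
  polynomial \<open>(1 - X) ^ n\<close>. The additive map \<open>\<pi>\<close> leads into a ring in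
  which these coefficients can act; it will be the identity on the field or a projection of
  pairs.\<close>

lemma one_minus_funpow:
  fixes f :: "'b::ab_group_add \<Rightarrow> 'b" and \<pi> :: "'b \<Rightarrow> 'a::comm_ring_1"
  assumes f: "\<And>x y. f (x - y) = f x - f y" and \<pi>: "\<And>x y. \<pi> (x - y) = \<pi> x - \<pi> y"
  shows "\<pi> (((\<lambda>x. x - f x) ^^ n) x) = (\<Sum>k\<le>n. Polynomial.coeff ([:1, - 1:] ^ n) k * \<pi> ((f ^^ k) x))"
proof (induction n arbitrary: x)
  case (Suc n)
  define c where "c = Polynomial.coeff ([:1, - 1 :: 'a:] ^ n)"
  define y where "y k = \<pi> ((f ^^ k) x)" for k
  have fk: "(f ^^ k) (x - y) = (f ^^ k) x - (f ^^ k) y" for k x y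
    by (induction k) (simp_all add: f)
  have "\<pi> (((\<lambda>x. x - f x) ^^ Suc n) x) = (\<Sum>k\<le>n. c k * (y k - y (Suc k)))"
    unfolding funpow_Suc_right o_apply Suc c_def y_def by (simp only: fk \<pi>)
  also have "\<dots> = (\<Sum>k\<le>n. c k * y k) - (\<Sum>k\<le>n. c k * y (Suc k))"
    by (simp add: algebra_simps sum_subtractf)
  also have "(\<Sum>k\<le>n. c k * y k) = (\<Sum>k\<le>Suc n. c k * y k)"
  proof -
    have "degree ([:1, - 1 :: 'a:] ^ n) \<le> degree [:1, - 1 :: 'a:] * n"
      by (rule degree_power_le)
    also have "\<dots> \<le> n"
      using degree_pCons_le[of 1 "[:- 1 :: 'a:]"] by simp
    finally have "c (Suc n) = 0"
      unfolding c_def by (intro coeff_eq_0) simp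
    then show ?thesis by simp
  qed
  also have "\<dots> = c 0 * y 0 + (\<Sum>k\<le>n. c (Suc k) * y (Suc k))"
    by (simp add: sum.atMost_Suc_shift del: sum.atMost_Suc)
  also have "\<dots> - (\<Sum>k\<le>n. c k * y (Suc k)) =
    (\<Sum>k\<le>Suc n. Polynomial.coeff ([:1, - 1:] ^ Suc n) k * y k)"
    unfolding sum.atMost_Suc_shift coeff_one_minus_X_power_Suc
    by (simp add: c_def algebra_simps sum_subtractf)
  finally show ?case by (simp only: y_def)
qed simp

text \<open>The first identity is additivity of the Frobenius map on polynomials, the sign being
  right as \<open>m\<close> is odd. Cancelling one factor \<open>1 - X\<close> leaves the geometric
  sum.\<close>

lemma one_minus_X_power_char:
  assumes "prime CHAR('a::field)" "odd CHAR('a)" "m = CHAR('a) ^ e"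
  shows "[:1, - 1 :: 'a:] ^ m = 1 - Polynomial.monom 1 m"
    and "[:1, - 1 :: 'a:] ^ (m - 1) = (\<Sum>k<m. Polynomial.monom 1 k)"
proof -
  have X: "[:1, - 1 :: 'a:] = 1 - Polynomial.monom 1 1"
    by (simp add: monom_altdef one_pCons)
  have "odd m" "m > 0"
    using assms by (auto simp: prime_gt_0_nat)
  have "[:1, - 1 :: 'a:] ^ m = (1 + - Polynomial.monom 1 1) ^ m"
    by (simp add: X)
  also have "\<dots> = 1 ^ m + (- Polynomial.monom 1 1) ^ m"
    by (rule freshmans_dream'[where n = e]) (use assms in auto)
  also have "\<dots> = 1 - Polynomial.monom 1 m"
    using \<open>odd m\<close> by (simp add: monom_power)
  finally show 1: "[:1, - 1 :: 'a:] ^ m = 1 - Polynomial.monom 1 m" .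
  have "[:1, - 1 :: 'a:] * [:1, - 1:] ^ (m - 1) = [:1, - 1:] ^ m"
    using \<open>m > 0\<close> by (metis power_minus_mult mult.commute)
  also have "\<dots> = [:1, - 1:] * (\<Sum>k<m. Polynomial.monom 1 k)"
    using one_diff_power_eq[of "Polynomial.monom (1 :: 'a) 1" m]
    unfolding 1 unfolding X by (simp add: monom_power)
  finally show "[:1, - 1 :: 'a:] ^ (m - 1) = (\<Sum>k<m. Polynomial.monom 1 k)"
    by (metis mult_cancel_left pCons_eq_0_iff zero_neq_one)
qed

lemma one_minus_funpow_char:
  fixes f :: "'b::ab_group_add \<Rightarrow> 'b" and \<pi> :: "'b \<Rightarrow> 'a::field"
  assumes f: "\<And>x y. f (x - y) = f x - f y" and \<pi>: "\<And>x y. \<pi> (x - y) = \<pi> x - \<pi> y"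
    and char: "prime CHAR('a)" "odd CHAR('a)" "m = CHAR('a) ^ e"
  shows "\<pi> (((\<lambda>x. x - f x) ^^ m) x) = \<pi> x - \<pi> ((f ^^ m) x)"
    and "\<pi> (((\<lambda>x. x - f x) ^^ (m - 1)) x) = (\<Sum>k<m. \<pi> ((f ^^ k) x))"
proof -
  have "m > 0"
    using char by (simp add: prime_gt_0_nat)
  have "\<pi> (((\<lambda>x. x - f x) ^^ m) x) =
    (\<Sum>k\<le>m. (if k = 0 then 1 else 0) * \<pi> ((f ^^ k) x) - (if k = m then 1 else 0) * \<pi> ((f ^^ k) x))"
    unfolding one_minus_funpow[of f \<pi>, OF f \<pi>] one_minus_X_power_char(1)[OF char]
    by (intro sum.cong) (auto simp: coeff_monom)
  also have "\<dots> = \<pi> x - \<pi> ((f ^^ m) x)"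
    by (simp add: sum_subtractf if_distrib[of "\<lambda>c. c * _"] cong: if_cong)
  finally show "\<pi> (((\<lambda>x. x - f x) ^^ m) x) = \<pi> x - \<pi> ((f ^^ m) x)" .
  show "\<pi> (((\<lambda>x. x - f x) ^^ (m - 1)) x) = (\<Sum>k<m. \<pi> ((f ^^ k) x))"
    unfolding one_minus_funpow[of f \<pi>, OF f \<pi>] one_minus_X_power_char(2)[OF char]
    using \<open>m > 0\<close> by (intro sum.cong) (auto simp: coeff_sum coeff_monom)
qed

text \<open>Multiplication by a nonzero \<open>x\<close> permutes the nonzero elements; comparing
  their products gives \<open>x ^ (q - 1) = 1\<close> for the field size \<open>q\<close>.\<close>

lemma finite_field_power_card: "(x :: 'a::{field,finite}) ^ CARD('a) = x"
proof (cases "x = 0")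
  case False
  have "bij_betw ((*) x) (UNIV - {0}) (UNIV - {0})"
    using False by (intro bij_betw_byWitness[where f' = "\<lambda>y. y / x"]) auto
  then have "\<Prod>(UNIV - {0}) = (\<Prod>y\<in>UNIV - {0}. x * y)"
    by (rule prod.reindex_bij_betw[symmetric])
  also have "\<dots> = x ^ (CARD('a) - 1) * \<Prod>(UNIV - {0})"
    by (simp add: prod.distrib card_Diff_singleton)
  finally have "x ^ (CARD('a) - 1) = 1"
    by simp
  moreover have "x ^ CARD('a) = x * x ^ (CARD('a) - 1)"
    by (metis finite_UNIV_card_ge_0 finite_class.finite_UNIV power_minus_mult mult.commute)
  ultimately show ?thesis
    by simp
qed simp

text \<open>The common setting: \<open>e = 1\<close> for Constructions B and C, and
  \<open>p = 3\<close>, \<open>e = 2\<close> for Construction D. The field has degree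
  \<open>p ^ e\<close> over the fixed field of \<open>g\<close>, which has \<open>p ^ l\<close>
  elements.\<close>

locale frobenius_field =
  fixes p e l :: nat and g :: "'a::{field,finite} \<Rightarrow> 'a"
  assumes p_prime: "prime p" and p_odd: "odd p" and card_eq: "CARD('a) = p ^ (p ^ e * l)"
    and l_gt_1: "l > 1" and g_eq: "g = (\<lambda>x. x ^ (p ^ l))"
begin

abbreviation (input) m :: nat where "m \<equiv> p ^ e"

lemma m_pos: "m > 0"
  using p_prime by (simp add: prime_gt_0_nat)

lemma CHAR_eq: "CHAR('a) = p"
proof -
  have "prime CHAR('a)"
    by (simp add: prime_CHAR_semidom finite_imp_CHAR_pos)
  moreover have "CHAR('a) dvd p ^ (m * l)"
    using CHAR_dvd_CARD[where 'a = 'a] by (simp add: card_eq)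
  ultimately show ?thesis
    using p_prime by (meson prime_dvd_power primes_dvd_imp_eq)
qed

lemma frob_add: "((x :: 'a) + y) ^ (p ^ i) = x ^ (p ^ i) + y ^ (p ^ i)"
  by (rule freshmans_dream'[where n = i]) (simp_all add: CHAR_eq p_prime)

lemma frob_sum: "(sum f A :: 'a) ^ (p ^ i) = (\<Sum>x\<in>A. f x ^ (p ^ i))"
  by (rule freshmans_dream_sum'[where n = i]) (simp_all add: CHAR_eq p_prime)

lemma frob_minus: "(- x :: 'a) ^ (p ^ i) = - (x ^ (p ^ i))"
  using p_odd by simp

lemma two_neq_0: "(2 :: 'a) \<noteq> 0"
proof -
  have "\<not> p dvd 2"
    using p_prime p_odd by (metis dvd_refl prime_nat_iff two_is_prime_nat prime_ge_2_nat primes_dvd_imp_eq)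
  then show ?thesis
    using of_nat_eq_0_iff_char_dvd[where 'a = 'a, of 2] by (simp add: CHAR_eq)
qed

lemma g_funpow: "(g ^^ j) x = x ^ (p ^ (l * j))"
  by (induction j) (simp_all add: g_eq power_add mult.commute flip: power_mult)

lemma g_funpow_m: "g ^^ m = id"
  using finite_field_power_card[where 'a = 'a] by (simp add: fun_eq_iff g_funpow card_eq mult.commute)

lemma g_in_field_auts: "g \<in> field_auts"
proof -
  have "inj g"
  proof (rule injI)
    fix x y assume "g x = g y"
    then have "(g ^^ m) x = (g ^^ m) y"
      using m_pos by (cases m) (simp_all add: funpow_swap1)
    then show "x = y"
      by (simp add: g_funpow_m)
  qed
  then show ?thesis
    by (auto simp: field_auts_def g_eq frob_add power_mult_distrib bij_def finite_UNIV_inj_surj)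
qed

lemma g_funpow_in_field_auts: "g ^^ j \<in> field_auts"
  by (induction j)
    (simp_all only: funpow.simps id_in_field_auts comp_in_field_auts g_in_field_auts)

lemmas g_hom = field_auts_hom[OF g_in_field_auts] and g_funpow_hom = field_auts_hom[OF g_funpow_in_field_auts]

lemma g_funpow_mod: "g ^^ (j mod m) = g ^^ j"
proof -
  have "g ^^ (m * k) = id" for k
    by (simp add: funpow_mult[symmetric] g_funpow_m)
  then have "g ^^ (j mod m + m * (j div m)) = g ^^ (j mod m)"
    by (simp only: funpow_add) simp
  then show ?thesis by simp
qed

lemma g_funpow_inverse: "\<exists>i. \<forall>x. (g ^^ i) ((g ^^ j) x) = x"
proof (intro exI allI)
  fix x
  have "(m - 1) * j + j = m * j"
    using m_pos by (cases m) simp_all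
  then have "g ^^ ((m - 1) * j + j) = g ^^ 0"
    by (metis g_funpow_mod mod_mult_self1_is_0)
  then show "(g ^^ ((m - 1) * j)) ((g ^^ j) x) = x"
    by (simp add: funpow_add fun_eq_iff)
qed

text \<open>The order divides \<open>m\<close> since \<open>g ^^ m = id\<close>. Conversely, if
  \<open>g ^^ k = id\<close> with \<open>k > 0\<close>, all field elements are roots of a nonzero
  polynomial of degree at most \<open>p ^ (l * k)\<close>, which forces
  \<open>m \<le> k\<close>.\<close>

lemma ord_g: "group.ord Aut_field g = m"
proof -
  interpret A: group "Aut_field :: ('a \<Rightarrow> 'a) monoid"
    by (rule group_Aut_field)
  have g: "g \<in> carrier Aut_field"
    by (simp add: Aut_field_def g_in_field_auts)
  have pow: "g [^]\<^bsub>Aut_field\<^esub> j = g ^^ j" for j :: nat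
    by (induction j) (simp_all add: Aut_field_def nat_pow_def)
  have dvd: "A.ord g dvd m"
    unfolding A.pow_eq_id[OF g, symmetric] pow g_funpow_m by (simp add: Aut_field_def)
  define k where "k = A.ord g"
  have "g ^^ k = id"
    using A.pow_ord_eq_1[OF g] unfolding pow k_def by (simp add: Aut_field_def)
  have "k > 0"
    using dvd m_pos by (auto simp: k_def intro: Nat.gr0I)
  define P where "P = Polynomial.monom (1 :: 'a) (p ^ (l * k)) - Polynomial.monom 1 1"
  have gt: "p ^ (l * k) > 1"
    using \<open>k > 0\<close> l_gt_1 p_prime by (intro one_less_power) (auto simp: prime_gt_Suc_0_nat)
  then have "Polynomial.coeff P (p ^ (l * k)) = 1"
    by (simp add: P_def coeff_monom)
  then have "P \<noteq> 0" by auto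
  have "degree P \<le> p ^ (l * k)"
    unfolding P_def using gt by (intro degree_diff_le) (auto simp: degree_monom_eq)
  moreover have "poly P x = 0" for x
    using \<open>g ^^ k = id\<close> g_funpow[of k x] by (simp add: P_def poly_monom)
  ultimately have "CARD('a) \<le> p ^ (l * k)"
    using card_poly_roots_bound[OF \<open>P \<noteq> 0\<close>] by simp
  then have "m * l \<le> l * k"
    unfolding card_eq using p_prime by (rule power_le_imp_le_exp[OF prime_gt_1_nat, rotated])
  then have "m \<le> k"
    using l_gt_1 by (simp add: mult.commute)
  then show ?thesis
    using dvd m_pos by (simp add: k_def dvd_imp_le le_antisym)
qed

section \<open>The filtration of the field by augmentation powers of the group generated by
  \<open>g\<close>\<close>

definition aug :: "nat \<Rightarrow> 'a set" where
  "aug k = range ((\<lambda>x. x - g x) ^^ k)"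

lemma aug_0: "aug 0 = UNIV"
  by (simp add: aug_def)

lemma one_minus_g_funpow_hom:
  "((\<lambda>x. x - g x) ^^ k) (x + y) = ((\<lambda>x. x - g x) ^^ k) x + ((\<lambda>x. x - g x) ^^ k) y"
  "((\<lambda>x. x - g x) ^^ k) (- x) = - ((\<lambda>x. x - g x) ^^ k) x"
  "((\<lambda>x. x - g x) ^^ k) 0 = 0"
  "((\<lambda>x. x - g x) ^^ k) ((g ^^ j) x) = (g ^^ j) (((\<lambda>x. x - g x) ^^ k) x)"
proof -
  have "g ((g ^^ j) x) = (g ^^ j) (g x)" for x
    by (simp add: funpow_swap1)
  then show "((\<lambda>x. x - g x) ^^ k) ((g ^^ j) x) = (g ^^ j) (((\<lambda>x. x - g x) ^^ k) x)"
    by (induction k) (simp_all add: g_funpow_hom)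
qed (induction k; simp add: g_hom)+

lemma aug_add: "x \<in> aug k \<Longrightarrow> y \<in> aug k \<Longrightarrow> x + y \<in> aug k"
  unfolding aug_def by (auto simp flip: one_minus_g_funpow_hom)

lemma aug_zero: "0 \<in> aug k"
  unfolding aug_def by (metis one_minus_g_funpow_hom(3) rangeI)

lemma aug_minus: "x \<in> aug k \<Longrightarrow> - x \<in> aug k"
  unfolding aug_def by (auto simp flip: one_minus_g_funpow_hom)

lemma aug_diff: "x \<in> aug k \<Longrightarrow> y \<in> aug k \<Longrightarrow> x - y \<in> aug k"
  using aug_add[of x k "- y"] aug_minus[of y k] by simp

lemma aug_funpow: "x \<in> aug k \<Longrightarrow> (g ^^ j) x \<in> aug k"
  unfolding aug_def by (auto simp flip: one_minus_g_funpow_hom)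

lemma aug_funpow_iff: "(g ^^ j) x \<in> aug k \<longleftrightarrow> x \<in> aug k"
  using aug_funpow g_funpow_inverse by metis

text \<open>By telescoping, \<open>g ^^ j - 1\<close> is a multiple of \<open>1 - g\<close>; this is
  how a commutator gains one step in the filtration.\<close>

lemma aug_Suc: "x \<in> aug k \<Longrightarrow> (g ^^ j) x - x \<in> aug (Suc k)"
proof (induction j)
  case 0
  then show ?case by (simp add: aug_zero)
next
  case (Suc j)
  have "(g ^^ j) x \<in> aug k"
    using Suc by (simp add: aug_funpow)
  then have "(g ^^ j) x - g ((g ^^ j) x) \<in> aug (Suc k)"
    unfolding aug_def by (auto simp: image_iff)
  then have "(g ^^ j) x - x - ((g ^^ j) x - g ((g ^^ j) x)) \<in> aug (Suc k)"
    using Suc by (meson aug_diff)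
  then show ?case by simp
qed

lemma aug_eq_0:
  assumes "k \<ge> m"
  shows "aug k = {0}"
proof -
  have "((\<lambda>x. x - g x) ^^ m) x = 0" for x
    using one_minus_funpow_char(1)[of g "\<lambda>x. x" m e x]
    by (simp add: g_hom CHAR_eq p_prime p_odd g_funpow_m)
  moreover have "((\<lambda>x. x - g x) ^^ k) x = ((\<lambda>x. x - g x) ^^ (k - m)) (((\<lambda>x. x - g x) ^^ m) x)" for x
    using assms by (metis comp_apply funpow_add le_add_diff_inverse2)
  ultimately have "((\<lambda>x. x - g x) ^^ k) x = 0" for x
    by (simp only: one_minus_g_funpow_hom)
  then show ?thesis
    by (auto simp: aug_def)
qed

section \<open>The absolute trace and the trace to the fixed field of \<open>g\<close>\<close>

definition Tr :: "'a \<Rightarrow> 'a" where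
  "Tr x = (\<Sum>j<m. (g ^^ j) x)"

abbreviation tr :: "'a \<Rightarrow> 'a" where
  "tr \<equiv> abs_trace p (m * l)"

lemma tr_add: "tr (x + y) = tr x + tr y"
  by (simp add: abs_trace_def frob_add sum.distrib)

lemma tr_minus: "tr (- x) = - tr x"
  by (simp add: abs_trace_def frob_minus sum_negf)

lemma tr_diff: "tr (x - y) = tr x - tr y"
  using tr_add[of x "- y"] by (simp add: tr_minus)

lemma tr_0: "tr 0 = 0"
  using tr_add[of 0 0] by (metis add_cancel_right_right)

lemma tr_sum: "tr (sum f A) = (\<Sum>x\<in>A. tr (f x))"
  by (simp add: abs_trace_def frob_sum sum.swap[of _ _ A])

text \<open>The \<open>p\<close>-th power map shifts the summands of the trace cyclically, because
  \<open>x ^ (p ^ (m * l)) = x\<close>.\<close>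

lemma tr_power_p: "tr (x ^ p) = tr x" and tr_in_prime_field: "tr x ^ p = tr x"
proof -
  define n where "n = m * l"
  have "n > 0"
    using m_pos l_gt_1 by (simp add: n_def)
  have "(\<Sum>i<n. x ^ (p ^ Suc i)) = (\<Sum>i<n. x ^ (p ^ i))"
    using sum.lessThan_Suc_shift[of "\<lambda>i. x ^ (p ^ i)" n] finite_field_power_card[of x]
    by (simp add: card_eq n_def)
  moreover have "tr (x ^ p) = (\<Sum>i<n. x ^ (p ^ Suc i))"
    by (simp add: abs_trace_def n_def flip: power_mult)
  moreover have "tr x ^ p = (\<Sum>i<n. x ^ (p ^ Suc i))"
    using frob_sum[of "\<lambda>i. x ^ (p ^ i)" "{..<n}" 1]
    by (simp add: abs_trace_def n_def mult.commute[of p] flip: power_mult)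
  ultimately show "tr (x ^ p) = tr x" "tr x ^ p = tr x"
    by (simp_all add: abs_trace_def n_def)
qed

lemma tr_frob: "tr (x ^ (p ^ i)) = tr x"
  by (induction i) (simp_all add: power_mult tr_power_p mult.commute[of p])

lemma tr_funpow: "tr ((g ^^ j) x) = tr x"
  by (simp add: g_funpow tr_frob)

lemma tr_scale:
  assumes "z ^ p = z"
  shows "tr (z * x) = z * tr x"
proof -
  have "z ^ (p ^ i) = z" for i
    by (induction i) (simp_all add: power_mult assms)
  then show ?thesis
    by (simp add: abs_trace_def power_mult_distrib sum_distrib_left)
qed

lemma Tr_scale:
  assumes "g z = z"
  shows "Tr (z * x) = z * Tr x"
proof -
  have "(g ^^ j) z = z" for j
    by (induction j) (simp_all add: assms)
  then show ?thesis
    by (simp add: Tr_def g_funpow_hom sum_distrib_left)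
qed

lemma g_Tr: "g (Tr x) = Tr x"
proof -
  have "(\<Sum>j<m. (g ^^ Suc j) x) = (\<Sum>j<m. (g ^^ j) x)"
    using sum.lessThan_Suc_shift[of "\<lambda>j. (g ^^ j) x" m] by (simp add: g_funpow_m del: funpow.simps(2))
  then show ?thesis
    by (simp add: Tr_def field_auts_sum[OF g_in_field_auts])
qed

text \<open>Transitivity of the trace: the exponents below \<open>m * l\<close> fall into
  \<open>m\<close> blocks of length \<open>l\<close>, and block \<open>j\<close> collects the first
  \<open>l\<close> Frobenius images of \<open>(g ^^ j) x\<close>.\<close>

lemma tr_eq_Tr: "tr x = (\<Sum>i<l. Tr x ^ (p ^ i))"
proof -
  have "tr x = (\<Sum>j<m. \<Sum>i\<in>{j * l..<j * l + l}. x ^ (p ^ i))"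
    by (simp add: abs_trace_def sum.nat_group)
  also have "\<dots> = (\<Sum>j<m. \<Sum>i<l. (g ^^ j) x ^ (p ^ i))"
  proof (rule sum.cong[OF refl])
    fix j
    have "(\<Sum>i\<in>{j * l..<j * l + l}. x ^ (p ^ i)) = (\<Sum>i<l. x ^ (p ^ (i + j * l)))"
      using sum.shift_bounds_nat_ivl[of "\<lambda>i. x ^ (p ^ i)" 0 "j * l" l]
      by (simp add: add.commute lessThan_atLeast0)
    also have "\<dots> = (\<Sum>i<l. (g ^^ j) x ^ (p ^ i))"
      by (simp add: g_funpow power_add mult.commute flip: power_mult)
    finally show "(\<Sum>i\<in>{j * l..<j * l + l}. x ^ (p ^ i)) = (\<Sum>i<l. (g ^^ j) x ^ (p ^ i))" .
  qed
  also have "\<dots> = (\<Sum>i<l. Tr x ^ (p ^ i))"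
    unfolding Tr_def frob_sum by (rule sum.swap)
  finally show ?thesis .
qed

text \<open>A factor \<open>z\<close> fixed by \<open>g\<close> comes out of \<open>Tr\<close>, so
  by transitivity \<open>Tr x = 0\<close> would make \<open>tr (z * x)\<close> vanish. This turns
  conditions on the absolute trace into conditions on \<open>Tr\<close>.\<close>

lemma Tr_neq_0I:
  assumes "g z = z" "tr (z * x) \<noteq> 0"
  shows "Tr x \<noteq> 0"
proof
  assume "Tr x = 0"
  then have "tr (z * x) = (\<Sum>i<l. 0 ^ (p ^ i))"
    using assms(1) by (simp add: tr_eq_Tr Tr_scale)
  then show False
    using assms(2) p_prime by (simp add: power_0_left prime_gt_0_nat)
qed

text \<open>The sum is a monic polynomial in \<open>x\<close> of degree \<open>f n\<close>; this
  bounds the kernels of both traces.\<close>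

lemma card_roots_sum_le:
  assumes "strict_mono f"
  shows "card {x :: 'a. (\<Sum>i<Suc n. x ^ f i) = 0} \<le> f n"
proof -
  define P where "P = (\<Sum>i<Suc n. Polynomial.monom (1 :: 'a) (f i))"
  have "f i = f n \<longleftrightarrow> i = n" for i
    using assms strict_mono_eq by blast
  then have "Polynomial.coeff P (f n) = 1"
    by (simp add: P_def coeff_sum coeff_monom del: sum.lessThan_Suc)
  then have "P \<noteq> 0" by auto
  have "degree P \<le> f n"
    unfolding P_def
    by (rule degree_sum_le) (auto simp: degree_monom_eq strict_mono_less_eq[OF assms])
  moreover have "poly P x = (\<Sum>i<Suc n. x ^ f i)" for x
    unfolding P_def by (simp add: poly_sum poly_monom)
  ultimately show ?thesis
    using card_poly_roots_bound[OF \<open>P \<noteq> 0\<close>] by simp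
qed

lemma card_Tr_ker: "card {x. Tr x = 0} \<le> p ^ (l * (m - 1))"
proof -
  have "strict_mono (\<lambda>j. p ^ (l * j))"
    using l_gt_1 p_prime by (auto intro!: strict_monoI power_strict_increasing simp: prime_gt_Suc_0_nat)
  from card_roots_sum_le[OF this, of "m - 1"] show ?thesis
    using m_pos by (simp add: Tr_def g_funpow del: sum.lessThan_Suc)
qed

lemma exists_tr_neq_0: "\<exists>x. tr x \<noteq> 0"
proof (rule ccontr)
  assume "\<nexists>x. tr x \<noteq> 0"
  then have "CARD('a) = card {x. tr x = 0}"
    by simp
  also have "\<dots> \<le> p ^ (m * l - 1)"
  proof -
    have "strict_mono (\<lambda>j. p ^ j)"
      using p_prime by (auto intro!: strict_monoI power_strict_increasing simp: prime_gt_Suc_0_nat)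
    from card_roots_sum_le[OF this, of "m * l - 1"] show ?thesis
      using m_pos l_gt_1 by (simp add: abs_trace_def del: sum.lessThan_Suc)
  qed
  also have "\<dots> < p ^ (m * l)"
    using m_pos l_gt_1 p_prime by (intro power_strict_increasing) (auto simp: prime_gt_Suc_0_nat)
  finally show False
    by (simp add: card_eq)
qed

text \<open>The trace is linear over the prime field, so one nonzero value can be scaled to any
  element of the prime field.\<close>

lemma tr_surj:
  assumes "\<mu> \<noteq> 0" "y ^ p = y"
  obtains x where "tr (\<mu> * x) = y"
proof -
  obtain w where w: "tr w \<noteq> 0"
    using exists_tr_neq_0 by blast
  have "(y / tr w) ^ p = y / tr w"
    using assms(2) tr_in_prime_field[of w] by (simp add: power_divide)
  then have "tr (y / tr w * w) = y"
    using w tr_scale[of "y / tr w" w] by simp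
  then show ?thesis
    using that[of "y / tr w * w / \<mu>"] assms(1) by simp
qed

lemma card_prime_field_le: "card {x :: 'a. x ^ p = x} \<le> p"
proof -
  define P where "P = Polynomial.monom (1 :: 'a) p - Polynomial.monom 1 1"
  have p1: "p > 1"
    using p_prime by (rule prime_gt_1_nat)
  then have "Polynomial.coeff P p = 1"
    by (simp add: P_def coeff_monom)
  then have "P \<noteq> 0" by auto
  have "degree P \<le> p"
    unfolding P_def using p1 by (intro degree_diff_le) (auto simp: degree_monom_eq)
  then show ?thesis
    using card_poly_roots_bound[OF \<open>P \<noteq> 0\<close>] by (simp add: P_def poly_monom)
qed

text \<open>A nonempty fibre of \<open>tr (\<mu> * _)\<close> is a translate of the kernel. Were the
  kernel contained in that of \<open>Tr\<close>, each of the at most \<open>p\<close> fibres would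
  have at most \<open>p ^ (l * (m - 1))\<close> elements, too few in total to fill the field as
  \<open>l > 1\<close>.\<close>

lemma exists_tr_0_Tr_neq_0:
  assumes "\<mu> \<noteq> 0"
  obtains b where "tr (\<mu> * b) = 0" "Tr b \<noteq> 0"
proof (rule ccontr)
  assume "\<not> thesis"
  then have sub: "{b. tr (\<mu> * b) = 0} \<subseteq> {b. Tr b = 0}"
    using that by auto
  have fibre: "card {x. tr (\<mu> * x) = y} \<le> p ^ (l * (m - 1))" for y
  proof (cases "\<exists>x. tr (\<mu> * x) = y")
    case True
    then obtain x where x: "tr (\<mu> * x) = y" by blast
    have "inj_on (\<lambda>z. z - x) {z. tr (\<mu> * z) = y}"
      by (auto simp: inj_on_def)
    moreover have "(\<lambda>z. z - x) ` {z. tr (\<mu> * z) = y} \<subseteq> {b. Tr b = 0}"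
      using sub x by (auto simp: right_diff_distrib tr_diff subset_iff)
    ultimately have "card {z. tr (\<mu> * z) = y} \<le> card {b. Tr b = 0}"
      by (intro card_inj_on_le) auto
    then show ?thesis
      using card_Tr_ker by simp
  qed simp
  have "CARD('a) = card (\<Union>y\<in>{y. y ^ p = y}. {x. tr (\<mu> * x) = y})"
    by (rule arg_cong[where f = card]) (auto simp: tr_in_prime_field)
  also have "\<dots> \<le> (\<Sum>y | y ^ p = y. card {x. tr (\<mu> * x) = y})"
    by (rule card_UN_le) simp
  also have "\<dots> \<le> of_nat (card {x :: 'a. x ^ p = x}) * p ^ (l * (m - 1))"
    by (rule sum_bounded_above) (rule fibre)
  also have "\<dots> \<le> p * p ^ (l * (m - 1))"
    using card_prime_field_le by simp
  also have "\<dots> = p ^ Suc (l * (m - 1))"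
    by simp
  also have "\<dots> < p ^ (m * l)"
  proof (rule power_strict_increasing)
    have "m * l = l * (m - 1) + l"
      using m_pos by (cases m) simp_all
    then show "Suc (l * (m - 1)) < m * l"
      using l_gt_1 by simp
  qed (use p_prime in \<open>simp add: prime_gt_Suc_0_nat\<close>)
  finally show False
    by (simp add: card_eq)
qed

text \<open>The \<open>p\<close> distinct values of \<open>of_nat\<close> exhaust the at most
  \<open>p\<close> solutions of \<open>x ^ p = x\<close>. This supplies natural exponents for
  \<open>prime_field_pow\<close>.\<close>

lemma prime_field_eq_of_nat:
  assumes "(x :: 'a) ^ p = x"
  obtains k where "x = of_nat k"
proof -
  have "of_nat ` {..<p} \<subseteq> {x :: 'a. x ^ p = x}"
  proof
    fix x :: 'a assume "x \<in> of_nat ` {..<p}"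
    then obtain k where "x = of_nat k" by blast
    moreover have "(of_nat k :: 'a) ^ p = of_nat k"
      using frob_add[of _ _ 1] p_prime by (induction k) (simp_all add: prime_gt_0_nat)
    ultimately show "x \<in> {x. x ^ p = x}" by simp
  qed
  moreover have "card (of_nat ` {..<p} :: 'a set) = p"
    by (subst card_image) (auto simp: inj_on_def of_nat_eq_iff_cong_CHAR CHAR_eq cong_def)
  ultimately have "of_nat ` {..<p} = {x :: 'a. x ^ p = x}"
    using card_prime_field_le by (intro card_seteq) auto
  then show ?thesis
    using assms that by blast
qed

end

section \<open>Bounds for the nilpotency class\<close>

context frobenius_field
begin

section \<open>Upper bound: a central chain of layers\<close>

text \<open>The truncated subtractions leave \<open>b\<close> unrestricted for \<open>k \<le> m\<close> and \<open>a\<close> for \<open>k \<le> 2 * m\<close>, because \<open>aug 0\<close>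
  is the whole field; \<open>c\<close> and \<open>t\<close> vanish for \<open>k \<ge> m\<close> and \<open>b\<close> for \<open>k \<ge> 2 * m\<close>.\<close>

definition layer :: "nat \<Rightarrow> 'a semilin set" where
  "layer k = {(E_mat a b c t, g ^^ j) | a b c t j. (k > 0 \<longrightarrow> g ^^ j = id) \<and>
     c \<in> aug k \<and> t \<in> aug k \<and> b \<in> aug (k - m) \<and> a \<in> aug (k - 2 * m)}"

lemma layerI:
  assumes "k > 0 \<Longrightarrow> g ^^ j = id" "c \<in> aug k" "t \<in> aug k"
    and "k \<ge> m \<Longrightarrow> b \<in> aug (k - m)" "k \<ge> 2 * m \<Longrightarrow> a \<in> aug (k - 2 * m)"
  shows "(E_mat a b c t, g ^^ j) \<in> layer k"
proof -
  have "b \<in> aug (k - m)" "a \<in> aug (k - 2 * m)"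
    using assms(4,5) by (cases "k \<ge> m"; cases "k \<ge> 2 * m"; simp add: aug_0)+
  then show ?thesis
    using assms(1-3) unfolding layer_def by blast
qed

lemma layerE:
  assumes "x \<in> layer k"
  obtains a b c t j where "x = (E_mat a b c t, g ^^ j)" "k > 0 \<longrightarrow> g ^^ j = id"
    "c \<in> aug k" "t \<in> aug k" "b \<in> aug (k - m)" "a \<in> aug (k - 2 * m)"
    "k \<ge> m \<longrightarrow> c = 0 \<and> t = 0" "k \<ge> 2 * m \<longrightarrow> b = 0"
proof -
  obtain a b c t j where *: "x = (E_mat a b c t, g ^^ j)" "k > 0 \<longrightarrow> g ^^ j = id"
    "c \<in> aug k" "t \<in> aug k" "b \<in> aug (k - m)" "a \<in> aug (k - 2 * m)"
    using assms unfolding layer_def by blast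
  moreover have "k \<ge> m \<longrightarrow> c = 0 \<and> t = 0"
    using *(3,4) aug_eq_0[of k] by auto
  moreover have "k \<ge> 2 * m \<longrightarrow> b = 0"
    using *(5) aug_eq_0[of "k - m"] by auto
  ultimately show ?thesis
    using that by blast
qed

text \<open>All cross terms contain an entry \<open>c\<close>, hence vanish for
  \<open>k \<ge> m\<close>. For smaller \<open>k\<close> the entries \<open>b\<close> and
  \<open>a\<close> are arbitrary.\<close>

lemma layer_mult:
  assumes "x \<in> layer k" "y \<in> layer k"
  shows "x \<otimes>\<^bsub>GammaL4\<^esub> y \<in> layer k"
proof -
  obtain a b c t j where x: "x = (E_mat a b c t, g ^^ j)" "k > 0 \<longrightarrow> g ^^ j = id"
    "c \<in> aug k" "t \<in> aug k" "b \<in> aug (k - m)" "a \<in> aug (k - 2 * m)"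
    "k \<ge> m \<longrightarrow> c = 0 \<and> t = 0" "k \<ge> 2 * m \<longrightarrow> b = 0"
    using assms(1) by (rule layerE)
  obtain a' b' c' t' i where y: "y = (E_mat a' b' c' t', g ^^ i)" "k > 0 \<longrightarrow> g ^^ i = id"
    "c' \<in> aug k" "t' \<in> aug k" "b' \<in> aug (k - m)" "a' \<in> aug (k - 2 * m)"
    "k \<ge> m \<longrightarrow> c' = 0 \<and> t' = 0" "k \<ge> 2 * m \<longrightarrow> b' = 0"
    using assms(2) by (rule layerE)
  show ?thesis
    unfolding x(1) y(1) semilin_E_mult[OF g_funpow_in_field_auts] funpow_add[symmetric]
    by (rule layerI) (use x(2-) y(2-) in
      \<open>auto intro!: aug_add aug_funpow simp: g_funpow_hom funpow_add\<close>)
qed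

lemma one_in_layer: "\<one>\<^bsub>GammaL4\<^esub> \<in> layer k"
  using layerI[of k 0 0 0 0 0] by (simp add: GammaL4_one E_mat_0 aug_zero id_def)

lemma layer_carrier: "layer k \<subseteq> carrier GammaL4"
  unfolding layer_def by (auto simp: GammaL4_carrier invertible_E_mat g_funpow_in_field_auts id_in_field_auts)

lemma subgroup_layer: "subgroup (layer k) GammaL4"
  using one_in_layer by (intro group.subgroupI_finite[OF group_GammaL4] layer_carrier layer_mult) auto

text \<open>Up to powers of \<open>g\<close>, the entry of \<open>z\<close> that has to shrink is
  the image of the corresponding entry of \<open>x\<close> under \<open>g ^^ r - 1\<close>, so that
  \<open>aug_Suc\<close> applies. An extra term occurs only for \<open>k = 0\<close>.\<close>

lemma commutator_in_layer_Suc: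
  assumes x: "x \<in> layer k" and h: "h \<in> layer 0" and z: "z \<in> layer 0"
    and eq: "z \<otimes>\<^bsub>GammaL4\<^esub> h \<otimes>\<^bsub>GammaL4\<^esub> x = x \<otimes>\<^bsub>GammaL4\<^esub> h"
  shows "z \<in> layer (Suc k)"
proof -
  obtain a b c t s where x: "x = (E_mat a b c t, g ^^ s)" "k > 0 \<longrightarrow> g ^^ s = id"
    "c \<in> aug k" "t \<in> aug k" "b \<in> aug (k - m)" "a \<in> aug (k - 2 * m)"
    "k \<ge> m \<longrightarrow> c = 0 \<and> t = 0" "k \<ge> 2 * m \<longrightarrow> b = 0"
    using x by (rule layerE)
  obtain a0 b0 c0 t0 r where h: "h = (E_mat a0 b0 c0 t0, g ^^ r)"
    using h by (rule layerE)
  obtain a' b' c' t' u where z: "z = (E_mat a' b' c' t', g ^^ u)"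
    using z by (rule layerE)
  note eq' = eq[unfolded x(1) h z semilin_E_mult[OF g_funpow_in_field_auts] prod.inject E_mat_eq_iff]
  obtain i where i: "\<And>y. (g ^^ i) ((g ^^ (r + s)) y) = y"
    using g_funpow_inverse by blast
  \<comment> \<open>The automorphism parts are powers of \<open>g\<close> and commute, so the
    equation forces that of \<open>z\<close> to be trivial.\<close>
  have "(g ^^ (r + s)) ((g ^^ u) y) = (g ^^ (r + s)) y" for y
  proof -
    have "(g ^^ s \<circ> (g ^^ r \<circ> g ^^ u)) y = (g ^^ r \<circ> g ^^ s) y"
      using eq' by simp
    then show ?thesis
      by (simp add: funpow_add) (metis comp_apply funpow_add add.commute)
  qed
  then have u: "g ^^ u = id"
    by (metis i eq_id_iff ext)
  \<comment> \<open>Here \<open>w\<close>, \<open>w0\<close>, \<open>w'\<close> stand for the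
    entries \<open>c\<close> or \<open>t\<close> of \<open>x\<close>, \<open>h\<close>,
    \<open>z\<close>. The term with \<open>w0\<close> survives only if \<open>x\<close> has a
    nontrivial automorphism part, hence only for \<open>k = 0\<close>, where it lies in
    \<open>aug 1\<close>.\<close>
  have comm: "(g ^^ s) ((g ^^ r) w') = (g ^^ r) w - w - ((g ^^ s) w0 - w0)"
    if "(g ^^ s) ((g ^^ r) w' + w0) + w = (g ^^ r) w + w0" for w w0 w' :: 'a
    using that by (simp add: g_funpow_hom algebra_simps)
  have aug_I: "w' \<in> aug (Suc k)"
    if "w \<in> aug k" "(g ^^ s) ((g ^^ r) w' + w0) + w = (g ^^ r) w + w0" for w w0 w'
  proof -
    have "(g ^^ s) w0 - w0 \<in> aug (Suc k)"
      using x(2) aug_Suc[of w0 0 s] by (cases "k = 0") (simp_all add: aug_0 aug_zero)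
    then have "(g ^^ s) ((g ^^ r) w') \<in> aug (Suc k)"
      using comm[OF that(2)] aug_Suc[OF that(1), of r] by (metis aug_diff)
    then show ?thesis
      by (simp only: aug_funpow_iff)
  qed
  have c': "c' \<in> aug (Suc k)" and t': "t' \<in> aug (Suc k)"
    using eq' by (auto intro: aug_I[OF x(3)] aug_I[OF x(4)])
  have b': "b' \<in> aug (Suc k - m)" and b'0: "Suc k - m \<ge> m \<Longrightarrow> b' = 0" if "k \<ge> m"
  proof -
    have 0: "c' = 0" "t' = 0" "c = 0" "t = 0" "g ^^ s = id"
      using c' t' aug_eq_0[of "Suc k"] x(2,7) that m_pos by auto
    then have "(g ^^ r) b' = (g ^^ r) b - b"
      using eq' by (simp add: g_funpow_hom algebra_simps)
    then have "(g ^^ r) b' \<in> aug (Suc (k - m))"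
      using aug_Suc[OF x(5)] by metis
    then show "b' \<in> aug (Suc k - m)"
      using that by (simp add: aug_funpow_iff Suc_diff_le)
    then show "Suc k - m \<ge> m \<Longrightarrow> b' = 0"
      using aug_eq_0 by blast
  qed
  have a': "a' \<in> aug (Suc k - 2 * m)" if "k \<ge> 2 * m"
  proof -
    have "k \<ge> m" using that by simp
    then have 0: "c' = 0" "t' = 0" "c = 0" "t = 0" "g ^^ s = id" "b = 0" "b' = 0"
      using c' t' aug_eq_0[of "Suc k"] x(2,7,8) that m_pos b'0 by auto
    then have "(g ^^ r) a' = (g ^^ r) a - a"
      using eq' by (simp add: g_funpow_hom algebra_simps)
    then have "(g ^^ r) a' \<in> aug (Suc (k - 2 * m))"
      using aug_Suc[OF x(6)] by metis
    then show ?thesis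
      using that by (simp add: aug_funpow_iff Suc_diff_le)
  qed
  show ?thesis
    unfolding z
  proof (rule layerI)
    \<comment> \<open>In the boundary cases \<open>Suc k = m\<close> for \<open>b'\<close> and
      \<open>Suc k = 2 * m\<close> for \<open>a'\<close> the required set is \<open>aug 0\<close>,
      the whole field.\<close>
    show "b' \<in> aug (Suc k - m)" if "m \<le> Suc k"
      using b' that by (cases "k \<ge> m") (auto simp: aug_0 le_Suc_eq)
    show "a' \<in> aug (Suc k - 2 * m)" if "2 * m \<le> Suc k"
      using a' that by (cases "k \<ge> 2 * m") (auto simp: aug_0 le_Suc_eq)
  qed (use u c' t' in auto)
qed

lemma layer_3m: "layer (3 * m) = {\<one>\<^bsub>GammaL4\<^esub>}"
proof -
  have "x = \<one>\<^bsub>GammaL4\<^esub>" if x: "x \<in> layer (3 * m)" for x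
  proof -
    obtain a b c t j where *: "x = (E_mat a b c t, g ^^ j)" "3 * m > 0 \<longrightarrow> g ^^ j = id"
      "c \<in> aug (3 * m)" "t \<in> aug (3 * m)" "b \<in> aug (3 * m - m)" "a \<in> aug (3 * m - 2 * m)"
      using x by (rule layerE)
    then have "a = 0" "b = 0" "c = 0" "t = 0" "g ^^ j = id"
      using aug_eq_0[of "3 * m"] aug_eq_0[of "3 * m - m"] aug_eq_0[of "3 * m - 2 * m"] m_pos by auto
    then show ?thesis
      by (simp add: *(1) GammaL4_one E_mat_0)
  qed
  then show ?thesis
    using one_in_layer by blast
qed

lemma lower_central_series_3m:
  assumes H: "subgroup H GammaL4" and "H \<subseteq> layer 0"
  shows "lower_central_series (GammaL4\<lparr>carrier := H\<rparr>) (3 * m) = {\<one>\<^bsub>GammaL4\<^esub>}"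
proof -
  interpret group "GammaL4 :: 'a semilin monoid"
    by (rule group_GammaL4)
  have comm: "x \<otimes>\<^bsub>GammaL4\<^esub> h \<otimes>\<^bsub>GammaL4\<^esub> inv\<^bsub>GammaL4\<^esub> x \<otimes>\<^bsub>GammaL4\<^esub> inv\<^bsub>GammaL4\<^esub> h \<in> layer (Suc k)"
    if "x \<in> layer k" "h \<in> H" for k x h
  proof (rule commutator_in_layer_Suc)
    show "x \<in> layer k" "h \<in> layer 0"
      using that assms(2) by auto
    have "x \<in> layer 0"
      using that(1) by (elim layerE) (auto simp: aug_0 intro: layerI)
    then show "x \<otimes>\<^bsub>GammaL4\<^esub> h \<otimes>\<^bsub>GammaL4\<^esub> inv\<^bsub>GammaL4\<^esub> x \<otimes>\<^bsub>GammaL4\<^esub> inv\<^bsub>GammaL4\<^esub> h \<in> layer 0"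
      using \<open>h \<in> layer 0\<close> subgroup_layer[of 0] by (intro subgroup.m_closed subgroup.m_inv_closed)
    show "x \<otimes>\<^bsub>GammaL4\<^esub> h \<otimes>\<^bsub>GammaL4\<^esub> inv\<^bsub>GammaL4\<^esub> x \<otimes>\<^bsub>GammaL4\<^esub> inv\<^bsub>GammaL4\<^esub> h \<otimes>\<^bsub>GammaL4\<^esub> h \<otimes>\<^bsub>GammaL4\<^esub> x
        = x \<otimes>\<^bsub>GammaL4\<^esub> h"
      using \<open>h \<in> layer 0\<close> \<open>x \<in> layer 0\<close> layer_carrier by (intro commutator_mult) auto
  qed
  have "lower_central_series (GammaL4\<lparr>carrier := H\<rparr>) (3 * m) \<subseteq> {\<one>\<^bsub>GammaL4\<^esub>}"
    using lower_central_series_subset[OF H subgroup_layer assms(2) comm, of "3 * m"] layer_3m by simp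
  moreover have "\<one>\<^bsub>GammaL4\<^esub> \<in> lower_central_series (GammaL4\<lparr>carrier := H\<rparr>) (3 * m)"
    using subgroup.one_closed[OF subgroup_lower_central_series[OF H]] by simp
  ultimately show ?thesis
    by blast
qed

section \<open>Lower bound: iterated commutation with a single element\<close>

text \<open>Conjugation \<open>x \<mapsto> h x h\<inverse>\<close> by \<open>h = (E(a\<^sub>0, b\<^sub>0, c, t\<^sub>0), g)\<close> on \<open>x = (E(a, b, 0, 0), 1)\<close>. The inverse of \<open>g\<close>
  is written as \<open>g ^^ (m - 1)\<close>.\<close>

definition conj_action :: "'a \<Rightarrow> 'a \<times> 'a \<Rightarrow> 'a \<times> 'a" where
  "conj_action c = (\<lambda>(a, b). ((g ^^ (m - 1)) (a + 2 * c * b), (g ^^ (m - 1)) b))"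

lemma conj_action_diff: "conj_action c (x - y) = conj_action c x - conj_action c y"
  by (cases x; cases y) (simp add: conj_action_def g_funpow_hom algebra_simps)

lemma g_funpow_pred: "g ((g ^^ (m - 1)) x) = x"
  using g_funpow_m m_pos by (metis Suc_diff_1 comp_apply funpow.simps(2) id_apply)

text \<open>Applying \<open>g ^^ k\<close> clears the inverse powers of \<open>g\<close> in the
  iterate. For \<open>k = m\<close> it is the identity and the sum becomes
  \<open>Tr c\<close>.\<close>

lemma conj_action_funpow:
  "(g ^^ k) (fst ((conj_action c ^^ k) (a, b))) = a + 2 * (\<Sum>j<k. (g ^^ j) c) * b"
  "(g ^^ k) (snd ((conj_action c ^^ k) (a, b))) = b"
proof (induction k)
  case (Suc k)
  obtain A B where AB: "(conj_action c ^^ k) (a, b) = (A, B)"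
    by (cases "(conj_action c ^^ k) (a, b)")
  have two: "(g ^^ k) 2 = 2"
    using g_funpow_hom(1)[of k 1 1] by (simp add: g_funpow_hom)
  have "(g ^^ Suc k) ((g ^^ (m - 1)) x) = (g ^^ k) x" for x
    by (simp only: funpow_Suc_right o_apply g_funpow_pred)
  moreover have "(g ^^ k) A = a + 2 * (\<Sum>j<k. (g ^^ j) c) * b" "(g ^^ k) B = b"
    using Suc AB by simp_all
  moreover have "(conj_action c ^^ Suc k) (a, b) = ((g ^^ (m - 1)) (A + 2 * c * B), (g ^^ (m - 1)) B)"
    by (simp add: AB) (simp add: conj_action_def)
  ultimately show
    "(g ^^ Suc k) (fst ((conj_action c ^^ Suc k) (a, b))) = a + 2 * (\<Sum>j<Suc k. (g ^^ j) c) * b"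
    "(g ^^ Suc k) (snd ((conj_action c ^^ Suc k) (a, b))) = b"
    by (simp_all only: fst_conv snd_conv g_funpow_hom two sum.lessThan_Suc)
      (simp add: algebra_simps)
qed simp_all

text \<open>The first \<open>m\<close> steps lead from \<open>(a, b)\<close> to
  \<open>(- 2 * Tr c * b, 0)\<close>. On pairs \<open>(w, 0)\<close> conjugation is just the inverse
  of \<open>g\<close>, so the other \<open>m - 1\<close> steps form the trace, from which the fixed
  element \<open>Tr c\<close> comes out.\<close>

lemma one_minus_conj_action_funpow:
  "fst (((\<lambda>x. x - conj_action c x) ^^ (2 * m - 1)) (a, b)) = - (2 * Tr c) * Tr b"
proof -
  define D where "D = (\<lambda>x. x - conj_action c x)"
  have char: "prime CHAR('a)" "odd CHAR('a)" "m = CHAR('a) ^ e"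
    using p_prime p_odd by (simp_all add: CHAR_eq)
  have fm: "(conj_action c ^^ m) (a, b) = (a + 2 * Tr c * b, b)"
    using conj_action_funpow[of m c a b] by (simp add: g_funpow_m Tr_def prod_eq_iff)
  have Dm: "(D ^^ m) (a, b) = (- (2 * Tr c * b), 0)"
    using one_minus_funpow_char(1)[of "conj_action c" fst m e "(a, b)", OF conj_action_diff fst_diff char]
      one_minus_funpow_char(1)[of "conj_action c" snd m e "(a, b)", OF conj_action_diff snd_diff char]
    by (simp add: fm D_def prod_eq_iff)
  have "fst ((conj_action c ^^ k) (w, 0)) = (g ^^ (m - k)) w" if "k < m" for k w
  proof -
    have "(g ^^ (m - k)) ((g ^^ k) y) = y" for y
      using that g_funpow_m by (metis comp_apply funpow_add id_apply le_add_diff_inverse2 less_imp_le)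
    then show ?thesis
      using conj_action_funpow(1)[of k c w 0] by (metis add.right_neutral mult_zero_right)
  qed
  then have "fst ((D ^^ (m - 1)) (w, 0)) = (\<Sum>k<m. (g ^^ (m - k)) w)" for w
    using one_minus_funpow_char(2)[of "conj_action c" fst m e "(w, 0)", OF conj_action_diff fst_diff char]
    by (simp add: D_def)
  \<comment> \<open>The exponents \<open>m - k\<close> run through 1 to \<open>m\<close> instead of
    0 to \<open>m - 1\<close>; the surplus \<open>g\<close> is harmless because it fixes
    \<open>Tr w\<close>.\<close>
  also have "(\<Sum>k<m. (g ^^ (m - k)) w) = (\<Sum>k<m. (g ^^ Suc (m - Suc k)) w)" for w
    by (intro sum.cong) (auto simp: Suc_diff_Suc simp del: funpow.simps)
  also have "\<dots> w = (\<Sum>k<m. (g ^^ Suc k) w)" for w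
    by (rule sum.nat_diff_reindex)
  also have "\<dots> w = Tr w" for w
    using g_Tr[of w] by (simp add: Tr_def field_auts_sum[OF g_in_field_auts])
  finally have Dm1: "fst ((D ^^ (m - 1)) (w, 0)) = Tr w" for w .
  have "(D ^^ (2 * m - 1)) (a, b) = (D ^^ (m - 1)) ((D ^^ m) (a, b))"
  proof -
    have "2 * m - 1 = m - 1 + m"
      using m_pos by simp
    then show ?thesis
      by (simp only: funpow_add o_apply)
  qed
  then have "fst ((D ^^ (2 * m - 1)) (a, b)) = Tr (- (2 * Tr c) * b)"
    using Dm1[of "- (2 * Tr c) * b"] by (simp add: Dm)
  also have "\<dots> = - (2 * Tr c) * Tr b"
    using g_hom(1)[of 1 1] by (intro Tr_scale) (simp add: g_hom g_Tr)
  finally show ?thesis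
    by (simp add: D_def)
qed

text \<open>Isolates what the constructions share: enough elements with \<open>c = t = 0\<close> and
  trivial automorphism part, and one element with automorphism part exactly \<open>g\<close> and
  \<open>Tr c\<^sub>0 \<noteq> 0\<close>.\<close>

lemma nilpotency_class_bounds:
  assumes H: "subgroup H GammaL4" and "H \<subseteq> layer 0"
    and \<mu>: "\<mu> \<noteq> 0" "g \<mu> = \<mu>"
    and B: "\<And>a b. tr (\<mu> * b) = 0 \<Longrightarrow> (E_mat a b 0 0, id) \<in> H"
    and h: "(E_mat a\<^sub>0 b\<^sub>0 c\<^sub>0 t\<^sub>0, g) \<in> H" and c\<^sub>0: "Tr c\<^sub>0 \<noteq> 0"
  shows "nilpotent_group (GammaL4\<lparr>carrier := H\<rparr>) \<and>
    nilpotency_class (GammaL4\<lparr>carrier := H\<rparr>) \<in> {2 * m..3 * m}"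
proof -
  interpret group "GammaL4 :: 'a semilin monoid"
    by (rule group_GammaL4)
  define G where "G = GammaL4\<lparr>carrier := H\<rparr>"
  define D where "D = (\<lambda>x. x - conj_action c\<^sub>0 x)"
  have one: "\<one>\<^bsub>G\<^esub> = (E_mat 0 0 0 0, id)"
    by (simp add: G_def GammaL4_one E_mat_0)
  have top: "lower_central_series G (3 * m) = {\<one>\<^bsub>G\<^esub>}"
    using lower_central_series_3m[OF H assms(2)] by (simp add: G_def)
  have "group G"
    unfolding G_def using H by (rule subgroup_imp_group)
  \<comment> \<open>The trace condition is carried along because it keeps the pairs inside
    \<open>H\<close>; it persists since \<open>g\<close> fixes \<open>\<mu>\<close> and leaves
    \<open>tr\<close> invariant.\<close>
  have D: "(E_mat (fst ((D ^^ n) (a, b))) (snd ((D ^^ n) (a, b))) 0 0, id) \<in> lower_central_series G n \<and>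
      tr (\<mu> * snd ((D ^^ n) (a, b))) = 0" if "tr (\<mu> * b) = 0" for n a b
  proof (induction n)
    case 0
    then show ?case
      using B[OF that] that by (simp add: G_def id_def)
  next
    case (Suc n)
    obtain a1 b1 where ab: "(D ^^ n) (a, b) = (a1, b1)"
      by (cases "(D ^^ n) (a, b)")
    define a2 b2 where "a2 = a1 - (g ^^ (m - 1)) (a1 + 2 * c\<^sub>0 * b1)" and "b2 = b1 - (g ^^ (m - 1)) b1"
    have D': "(D ^^ Suc n) (a, b) = (a2, b2)"
      by (simp add: ab) (simp add: D_def conj_action_def a2_def b2_def)
    have "(g ^^ (m - 1)) \<mu> = \<mu>"
      by (metis \<mu>(2) g_funpow_pred funpow_swap1)
    then have "tr (\<mu> * (g ^^ (m - 1)) b1) = tr (\<mu> * b1)"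
      using tr_funpow[of "m - 1" "\<mu> * b1"] by (simp add: g_funpow_hom)
    then have b2: "tr (\<mu> * b2) = 0"
      using Suc by (simp add: b2_def ab right_diff_distrib tr_diff)
    have "(E_mat a2 b2 0 0, id) \<otimes>\<^bsub>GammaL4\<^esub> (E_mat a\<^sub>0 b\<^sub>0 c\<^sub>0 t\<^sub>0, g) \<otimes>\<^bsub>GammaL4\<^esub> (E_mat a1 b1 0 0, id) =
      (E_mat a1 b1 0 0, id) \<otimes>\<^bsub>GammaL4\<^esub> (E_mat a\<^sub>0 b\<^sub>0 c\<^sub>0 t\<^sub>0, g)"
      unfolding semilin_E_mult[OF g_in_field_auts] semilin_E_mult[OF id_in_field_auts]
      by (simp add: a2_def b2_def g_hom g_funpow_pred[simplified] E_mat_eq_iff algebra_simps)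
    then have "(E_mat a2 b2 0 0, id) \<in> lower_central_series G (Suc n)"
      unfolding G_def using Suc h B[OF b2] ab
      by (intro commutator_in_lower_central_series[OF H]) (auto simp: G_def id_def)
    then show ?case
      using b2 by (simp only: D' fst_conv snd_conv)
  qed
  have D0: "(D ^^ n) (0, 0) = (0, 0)" for n
    by (induction n) (simp_all add: D_def conj_action_def g_funpow_hom zero_prod_def)
  \<comment> \<open>If the series were trivial at some \<open>n < 2 * m\<close>, then
    \<open>D ^^ n\<close>, and hence \<open>D ^^ (2 * m - 1)\<close>, would kill
    \<open>(0, b)\<close> for a \<open>b\<close> with \<open>Tr b \<noteq> 0\<close>.\<close>
  have lower: "2 * m \<le> n" if n: "lower_central_series G n = {\<one>\<^bsub>G\<^esub>}" for n
  proof (rule ccontr)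
    assume "\<not> 2 * m \<le> n"
    obtain b where b: "tr (\<mu> * b) = 0" "Tr b \<noteq> 0"
      using \<mu>(1) by (rule exists_tr_0_Tr_neq_0)
    have "(D ^^ n) (0, b) = (0, 0)"
      using D[OF b(1), of n 0] n by (simp add: one E_mat_eq_iff prod_eq_iff)
    moreover have "2 * m - 1 = (2 * m - 1 - n) + n"
      using \<open>\<not> 2 * m \<le> n\<close> by simp
    ultimately have "(D ^^ (2 * m - 1)) (0, b) = (0, 0)"
      using D0 by (metis comp_apply funpow_add)
    then show False
      using one_minus_conj_action_funpow[of c\<^sub>0 0 b] b(2) c\<^sub>0 two_neq_0 by (simp add: D_def)
  qed
  have "nilpotent_group G"
    using \<open>group G\<close> top by (auto simp: nilpotent_group_def)
  moreover have "nilpotency_class G \<le> 3 * m"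
    unfolding nilpotency_class_def using top by (rule Least_le)
  moreover have "2 * m \<le> nilpotency_class G"
    unfolding nilpotency_class_def using top by (intro lower) (rule LeastI)
  ultimately show ?thesis
    by (simp add: G_def)
qed

end

section \<open>The three constructions\<close>

lemma prime_field_pow_0: "prime_field_pow f 0 = id"
  by (simp add: prime_field_pow_def Least_equality id_def)

lemma prime_field_pow_1: "prime_field_pow f (1 :: 'a::field) = f"
proof -
  have "(LEAST k. of_nat k = (1 :: 'a)) = 1"
  proof (rule Least_equality)
    show "1 \<le> k" if "of_nat k = (1 :: 'a)" for k
      using that by (cases k) auto
  qed simp
  then show ?thesis
    by (simp add: prime_field_pow_def)
qed

lemma poly_lin_poly: "poly (lin_poly p n s) x = (\<Sum>i<n. s i * x ^ (p ^ i))"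
  by (simp add: lin_poly_def poly_sum poly_monom)

lemma poly_lin_poly_0: "p > 0 \<Longrightarrow> poly (lin_poly p n s) 0 = 0"
  by (simp add: poly_lin_poly power_0_left)

text \<open>The exponents \<open>p ^ i\<close> are distinct. This passes the condition on the
  coefficients of the polynomial in Construction B to the sequence \<open>s\<close>.\<close>

lemma coeff_lin_poly:
  assumes "p > 1" "i < n"
  shows "Polynomial.coeff (lin_poly p n s) (p ^ i) = s i"
  using assms by (simp add: lin_poly_def coeff_sum coeff_monom)

context frobenius_field
begin

lemma E_mat_in_layer_0: "(E_mat a b c t, g ^^ j) \<in> layer 0"
  by (rule layerI) (simp_all add: aug_0)

text \<open>Serves Constructions B and C with \<open>i = 1\<close> and Construction D with
  \<open>i = 3\<close>.\<close>

lemma prime_field_pow_in_layer_0: "(E_mat a b c t, prime_field_pow (g ^^ i) x) \<in> layer 0"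
  unfolding prime_field_pow_def funpow_mult by (rule E_mat_in_layer_0)

lemma subgroupI_layer_0:
  assumes "H \<subseteq> layer 0" "H \<noteq> {}" "\<And>x y. x \<in> H \<Longrightarrow> y \<in> H \<Longrightarrow> x \<otimes>\<^bsub>GammaL4\<^esub> y \<in> H"
  shows "subgroup H GammaL4"
  using assms layer_carrier[of 0] by (intro group.subgroupI_finite[OF group_GammaL4]) auto

lemma in_subfield_iff: "x \<in> subfield_of_order (p ^ l) \<longleftrightarrow> g x = x"
  by (simp add: subfield_of_order_def g_eq)

lemma g_funpow_fixed: "g x = x \<Longrightarrow> (g ^^ j) x = x"
  by (induction j) simp_all

text \<open>The least representative is congruent to \<open>k\<close> modulo the characteristic,
  which for \<open>m = p\<close> is the order of \<open>g\<close>.\<close>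

lemma prime_field_pow_of_nat:
  assumes "m = p"
  shows "prime_field_pow g (of_nat k) = g ^^ k"
proof -
  define k' where "k' = (LEAST i. of_nat i = (of_nat k :: 'a))"
  have "of_nat k' = (of_nat k :: 'a)"
    unfolding k'_def by (rule LeastI) (rule refl)
  then have "k' mod m = k mod m"
    by (simp add: of_nat_eq_iff_cong_CHAR CHAR_eq cong_def assms)
  then show ?thesis
    unfolding prime_field_pow_def k'_def[symmetric] by (metis g_funpow_mod)
qed

lemma prime_field_pow_add:
  assumes "m = p" "x ^ p = x" "y ^ p = y"
  shows "prime_field_pow g (x + y) = prime_field_pow g y \<circ> prime_field_pow g x"
proof -
  obtain i j where "x = of_nat i" "y = of_nat j"
    using assms(2,3) by (metis prime_field_eq_of_nat)
  moreover from this have "x + y = of_nat (j + i)"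
    by (simp add: add.commute)
  ultimately show ?thesis
    using assms(1) by (simp only: prime_field_pow_of_nat funpow_add)
qed

lemma lin_poly_add: "poly (lin_poly p n s) ((x :: 'a) + y) = poly (lin_poly p n s) x + poly (lin_poly p n s) y"
  by (simp add: poly_lin_poly frob_add distrib_left sum.distrib)

lemma lin_poly_funpow:
  assumes "\<And>i. i < n \<Longrightarrow> g (s i) = s i"
  shows "poly (lin_poly p n s) ((g ^^ j) x) = (g ^^ j) (poly (lin_poly p n s) x)"
proof -
  have "(g ^^ j) (s i * x ^ (p ^ i)) = s i * (g ^^ j) x ^ (p ^ i)" if "i < n" for i
    using g_funpow_fixed[OF assms[OF that]]
    by (simp add: g_funpow_hom) (simp add: g_funpow mult.commute flip: power_mult)
  then show ?thesis
    by (simp add: poly_lin_poly field_auts_sum[OF g_funpow_in_field_auts])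
qed

lemma tr_mult_funpow: "g \<mu> = \<mu> \<Longrightarrow> tr (\<mu> * (g ^^ j) x) = tr (\<mu> * x)"
  using tr_funpow[of j "\<mu> * x"] by (simp add: g_funpow_hom g_funpow_fixed)

text \<open>Closure holds because the entry \<open>c\<close> of a product is
  \<open>\<tau> c + c'\<close>, while both the linearized polynomial and
  \<open>tr (\<mu> * _)\<close> are additive and compatible with powers of \<open>g\<close>.\<close>

lemma construction_B_bounds:
  assumes "m = p" and s: "\<And>i. i < n \<Longrightarrow> g (s i) = s i" and \<mu>: "\<mu> \<noteq> 0" "g \<mu> = \<mu>"
    and H: "H = {(E_mat a b c (poly (lin_poly p n s) c), prime_field_pow g (tr (\<mu> * c))) | a b c. True}"
  shows "nilpotent_group (GammaL4\<lparr>carrier := H\<rparr>) \<and>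
    nilpotency_class (GammaL4\<lparr>carrier := H\<rparr>) \<in> {2 * m..3 * m}"
proof -
  define S where "S = poly (lin_poly p n s)"
  have H': "(E_mat a b c (S c), prime_field_pow g (tr (\<mu> * c))) \<in> H" for a b c
    unfolding H S_def by blast
  have layer: "H \<subseteq> layer 0"
    unfolding H using prime_field_pow_in_layer_0[of _ _ _ _ 1] by auto
  have "subgroup H GammaL4"
  proof (rule subgroupI_layer_0[OF layer])
    fix x y assume "x \<in> H" "y \<in> H"
    then obtain a b c a' b' c' where xy: "x = (E_mat a b c (S c), prime_field_pow g (tr (\<mu> * c)))"
      "y = (E_mat a' b' c' (S c'), prime_field_pow g (tr (\<mu> * c')))"
      unfolding H S_def by blast
    define \<tau> where "\<tau> = prime_field_pow g (tr (\<mu> * c'))"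
    obtain j where \<tau>: "\<tau> = g ^^ j"
      unfolding \<tau>_def prime_field_pow_def by blast
    have "S (\<tau> c + c') = \<tau> (S c) + S c'"
      unfolding S_def \<tau> using s by (simp add: lin_poly_add lin_poly_funpow)
    moreover have "prime_field_pow g (tr (\<mu> * (\<tau> c + c'))) = \<tau> \<circ> prime_field_pow g (tr (\<mu> * c))"
      using prime_field_pow_add[OF assms(1) tr_in_prime_field tr_in_prime_field] \<mu>(2)
      by (simp add: distrib_left tr_add \<tau> tr_mult_funpow) (simp add: \<tau>_def flip: \<tau>)
    ultimately show "x \<otimes>\<^bsub>GammaL4\<^esub> y \<in> H"
      using H'[of _ _ "\<tau> c + c'"] g_funpow_in_field_auts[of j]
      by (simp add: xy semilin_E_mult flip: \<tau>_def \<tau>)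
  qed (use H' in blast)
  moreover have "(E_mat a b 0 0, id) \<in> H" for a b
    using H'[of a b 0] p_prime
    by (simp add: S_def poly_lin_poly_0 prime_gt_0_nat tr_0 prime_field_pow_0)
  \<comment> \<open>One \<open>c\<^sub>0\<close> does both jobs: the exponent 1 makes the
    automorphism part \<open>g\<close>, and a nonzero absolute trace gives
    \<open>Tr c\<^sub>0 \<noteq> 0\<close>.\<close>
  moreover obtain c\<^sub>0 where c\<^sub>0: "tr (\<mu> * c\<^sub>0) = 1"
    using tr_surj[OF \<mu>(1), of 1] by (metis power_one)
  moreover have "(E_mat 0 0 c\<^sub>0 (S c\<^sub>0), g) \<in> H"
    using H'[of 0 0 c\<^sub>0] by (simp add: c\<^sub>0 prime_field_pow_1)
  moreover have "Tr c\<^sub>0 \<noteq> 0"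
    using \<mu>(2) c\<^sub>0 by (intro Tr_neq_0I[of \<mu>]) simp_all
  ultimately show ?thesis
    using layer \<mu> by (intro nilpotency_class_bounds[where \<mu> = \<mu>]) auto
qed

text \<open>Raising the \<open>i\<close>-th summand to the power \<open>p ^ (m * l - i)\<close>
  keeps its trace and, by the relations on \<open>s\<close>, turns it into the summand of index
  \<open>m * l - i\<close> with \<open>x\<close> and \<open>y\<close> exchanged.\<close>

lemma tr_lin_poly_symmetric:
  assumes s: "\<And>i. i \<in> {1..m * l - 1} \<Longrightarrow> \<mu> * s i = s (m * l - i) ^ (p ^ i) * \<mu> ^ (p ^ i)"
  shows "tr (\<mu> * x * poly (lin_poly p (m * l) s) y) = tr (\<mu> * y * poly (lin_poly p (m * l) s) x)"
proof -
  define n where "n = m * l"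
  have "n > 0"
    using m_pos l_gt_1 by (simp add: n_def)
  have split: "tr (\<mu> * x * poly (lin_poly p n s) y) =
      tr (\<mu> * s 0 * x * y) + (\<Sum>i\<in>{1..n - 1}. tr (\<mu> * s i * x * y ^ (p ^ i)))" for x y
  proof -
    have "{..<n} = insert 0 {1..n - 1}"
      using \<open>n > 0\<close> by auto
    then have "\<mu> * x * poly (lin_poly p n s) y =
        \<mu> * s 0 * x * y + (\<Sum>i\<in>{1..n - 1}. \<mu> * s i * x * y ^ (p ^ i))"
      by (simp add: poly_lin_poly sum_distrib_left distrib_left mult_ac)
    then show ?thesis
      by (simp only: tr_add tr_sum)
  qed
  have "tr (\<mu> * s i * x * y ^ (p ^ i)) = tr (\<mu> * s (n - i) * y * x ^ (p ^ (n - i)))"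
    if i: "i \<in> {1..n - 1}" for i
  proof -
    have "i + (n - i) = n"
      using i by auto
    have "tr (\<mu> * s i * x * y ^ (p ^ i)) = tr ((\<mu> * s i * x * y ^ (p ^ i)) ^ (p ^ (n - i)))"
      by (rule tr_frob[symmetric])
    also have "(\<mu> * s i * x * y ^ (p ^ i)) ^ (p ^ (n - i)) =
      (s i ^ (p ^ (n - i)) * \<mu> ^ (p ^ (n - i))) * x ^ (p ^ (n - i)) * y ^ (p ^ n)"
      by (simp add: power_mult_distrib mult_ac \<open>i + (n - i) = n\<close> flip: power_mult power_add)
    also have "s i ^ (p ^ (n - i)) * \<mu> ^ (p ^ (n - i)) = \<mu> * s (n - i)"
    proof -
      have "n - i \<in> {1..n - 1}" "n - (n - i) = i"
        using i by auto
      then show ?thesis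
        using s[of "n - i"] by (simp only: n_def)
    qed
    also have "y ^ (p ^ n) = y"
      using finite_field_power_card[of y] by (simp add: card_eq n_def)
    finally show ?thesis
      by (simp add: mult_ac)
  qed
  then have "(\<Sum>i\<in>{1..n - 1}. tr (\<mu> * s i * x * y ^ (p ^ i))) =
    (\<Sum>i\<in>{1..n - 1}. tr (\<mu> * s i * y * x ^ (p ^ i)))"
    by (intro sum.reindex_bij_witness[of _ "\<lambda>i. n - i" "\<lambda>i. n - i"]) auto
  moreover have "\<mu> * s 0 * x * y = \<mu> * s 0 * y * x"
    by (simp add: mult_ac)
  ultimately have "tr (\<mu> * x * poly (lin_poly p n s) y) = tr (\<mu> * y * poly (lin_poly p n s) x)"
    by (simp only: split)
  then show ?thesis
    by (simp only: n_def)
qed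

text \<open>By the symmetry above, half of \<open>Q\<close> fails to be additive exactly by
  \<open>- tr (\<mu> * x * S y)\<close>. The cross term \<open>\<tau> c * S c'\<close> in the entry
  \<open>b\<close> of a product cancels this, so exponents add and the set is closed.\<close>

lemma construction_C_bounds:
  assumes "m = p" and s: "\<And>i. i < m * l \<Longrightarrow> g (s i) = s i" and \<mu>: "\<mu> \<noteq> 0" "g \<mu> = \<mu>"
    and sym: "\<And>i. i \<in> {1..m * l - 1} \<Longrightarrow> \<mu> * s i = s (m * l - i) ^ (p ^ i) * \<mu> ^ (p ^ i)"
    and Q: "Q = (\<lambda>x. - tr (\<mu> * x * poly (lin_poly p (m * l) s) x))"
    and H: "H = {(E_mat a b c (poly (lin_poly p (m * l) s) c),
      prime_field_pow g (1 / 2 * Q c + tr (\<mu> * b))) | a b c. True}"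
  shows "nilpotent_group (GammaL4\<lparr>carrier := H\<rparr>) \<and>
    nilpotency_class (GammaL4\<lparr>carrier := H\<rparr>) \<in> {2 * m..3 * m}"
proof -
  define S where "S = poly (lin_poly p (m * l) s)"
  define \<theta> where "\<theta> b c = 1 / 2 * Q c + tr (\<mu> * b)" for b c
  have H': "(E_mat a b c (S c), prime_field_pow g (\<theta> b c)) \<in> H" for a b c
    unfolding H S_def \<theta>_def by blast
  have layer: "H \<subseteq> layer 0"
    unfolding H using prime_field_pow_in_layer_0[of _ _ _ _ 1] by auto
  have S: "S (x + y) = S x + S y" "S ((g ^^ j) x) = (g ^^ j) (S x)" "S 0 = 0" for x y j
    unfolding S_def using s p_prime by (simp_all add: lin_poly_add lin_poly_funpow poly_lin_poly_0 prime_gt_0_nat)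
  have Q_add: "1 / 2 * Q (x + y) = 1 / 2 * Q x + 1 / 2 * Q y - tr (\<mu> * (x * S y))" for x y
  proof -
    have "tr (\<mu> * x * S y) = tr (\<mu> * y * S x)"
      unfolding S_def using sym by (rule tr_lin_poly_symmetric)
    then have "Q (x + y) = Q x + Q y - 2 * tr (\<mu> * (x * S y))"
      unfolding Q S_def[symmetric] S(1) distrib_left distrib_right tr_add by (simp add: mult.assoc)
    then show ?thesis
      using two_neq_0 by (simp add: add_divide_distrib diff_divide_distrib)
  qed
  have Q_funpow: "Q ((g ^^ j) x) = Q x" for j x
    using tr_mult_funpow[OF \<mu>(2), of j "x * S x"]
    by (simp add: Q S mult.assoc g_funpow_hom flip: S_def)
  have prime_field: "\<theta> b c ^ p = \<theta> b c" for b c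
  proof -
    have "(2 :: 'a) ^ p = 2"
      using frob_add[of 1 1 1] by simp
    then have "(1 / 2 * Q c) ^ p = 1 / 2 * Q c"
      using tr_in_prime_field frob_minus[of _ 1] by (simp add: power_divide Q flip: S_def)
    then show ?thesis
      using frob_add[of "1 / 2 * Q c" "tr (\<mu> * b)" 1] tr_in_prime_field by (simp add: \<theta>_def)
  qed
  have "subgroup H GammaL4"
  proof (rule subgroupI_layer_0[OF layer])
    fix x y assume "x \<in> H" "y \<in> H"
    then obtain a b c a' b' c' where xy: "x = (E_mat a b c (S c), prime_field_pow g (\<theta> b c))"
      "y = (E_mat a' b' c' (S c'), prime_field_pow g (\<theta> b' c'))"
      unfolding H S_def \<theta>_def by blast
    define \<tau> where "\<tau> = prime_field_pow g (\<theta> b' c')"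
    obtain j where \<tau>: "\<tau> = g ^^ j"
      unfolding \<tau>_def prime_field_pow_def by blast
    have "S (\<tau> c + c') = \<tau> (S c) + S c'"
      by (simp add: \<tau> S)
    moreover have "\<theta> (\<tau> b + b' + \<tau> c * S c') (\<tau> c + c') = \<theta> b c + \<theta> b' c'"
      unfolding \<theta>_def Q_add using \<mu>(2)
      by (simp add: \<tau> Q_funpow distrib_left tr_add tr_mult_funpow)
    then have "prime_field_pow g (\<theta> (\<tau> b + b' + \<tau> c * S c') (\<tau> c + c')) =
      \<tau> \<circ> prime_field_pow g (\<theta> b c)"
      using prime_field_pow_add[OF assms(1) prime_field prime_field] by (simp add: \<tau>_def)
    ultimately show "x \<otimes>\<^bsub>GammaL4\<^esub> y \<in> H"
      using H'[of _ "\<tau> b + b' + \<tau> c * S c'" "\<tau> c + c'"] g_funpow_in_field_auts[of j]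
      by (simp add: xy semilin_E_mult flip: \<tau>_def \<tau>)
  qed (use H' in blast)
  moreover have "(E_mat a b 0 0, id) \<in> H" if "tr (\<mu> * b) = 0" for a b
    using H'[of a b 0] that by (simp add: \<theta>_def Q S tr_0 prime_field_pow_0 flip: S_def)
  moreover obtain c\<^sub>0 where c\<^sub>0: "Tr c\<^sub>0 \<noteq> 0"
    using exists_tr_0_Tr_neq_0[OF \<mu>(1)] by blast
  \<comment> \<open>With \<open>c\<^sub>0\<close> fixed, the free entry \<open>b\<close> corrects
    the exponent to 1, because \<open>tr (\<mu> * _)\<close> maps onto the prime field.\<close>
  moreover obtain b\<^sub>0 where "\<theta> b\<^sub>0 c\<^sub>0 = 1"
  proof -
    have "(1 - \<theta> 0 c\<^sub>0) ^ p = 1 - \<theta> 0 c\<^sub>0"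
      using frob_add[of 1 "- \<theta> 0 c\<^sub>0" 1] frob_minus[of _ 1] prime_field by simp
    then obtain b where "tr (\<mu> * b) = 1 - \<theta> 0 c\<^sub>0"
      using tr_surj[OF \<mu>(1)] by blast
    then have "\<theta> b c\<^sub>0 = 1"
      by (simp add: \<theta>_def tr_0)
    then show ?thesis
      using that by blast
  qed
  moreover from this have "(E_mat 0 b\<^sub>0 c\<^sub>0 (S c\<^sub>0), g) \<in> H"
    using H'[of 0 b\<^sub>0 c\<^sub>0] by (simp add: prime_field_pow_1)
  ultimately show ?thesis
    using layer \<mu> by (intro nilpotency_class_bounds[where \<mu> = \<mu>]) auto
qed

end

section \<open>From the definitions of the constructions to the common bounds\<close>

lemma construction_B_nilpotency_class:
  fixes g :: "'a::{field,finite} \<Rightarrow> 'a"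
  assumes "construction_B p l g G" "l > 1"
  shows "nilpotent_group G \<and>
    nilpotency_class G \<in> {2 * group.ord Aut_field g..3 * group.ord Aut_field g}"
proof -
  obtain s \<mu> where p: "prime p" "odd p" and card: "CARD('a) = p ^ (p * l)"
    and g: "g = (\<lambda>x. x ^ (p ^ l))"
    and s: "\<And>i. Polynomial.coeff (lin_poly p (p * l) s) i \<in> subfield_of_order (p ^ l)"
    and \<mu>: "\<mu> \<in> subfield_of_order (p ^ l) - {0}"
    and G: "G = GammaL4\<lparr>carrier := {(E_mat a b c (poly (lin_poly p (p * l) s) c),
      prime_field_pow g (abs_trace p (p * l) (\<mu> * c))) | a b c. True}\<rparr>"
    using assms(1) unfolding construction_B_def reduced_linearized_def by auto
  interpret frobenius_field p 1 l g
    using p card g assms(2) by unfold_locales auto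
  have "g (s i) = s i" if "i < p * l" for i
    using s[of "p ^ i"] that coeff_lin_poly[of p i "p * l" s] p(1)
    by (simp add: in_subfield_iff prime_gt_Suc_0_nat)
  then show ?thesis
    unfolding G ord_g using \<mu> by (intro construction_B_bounds) (auto simp: in_subfield_iff)
qed

lemma construction_C_nilpotency_class:
  fixes g :: "'a::{field,finite} \<Rightarrow> 'a"
  assumes "construction_C p l g G" "l > 1"
  shows "nilpotent_group G \<and>
    nilpotency_class G \<in> {2 * group.ord Aut_field g..3 * group.ord Aut_field g}"
proof -
  obtain \<mu> s Q where p: "prime p" "odd p" and card: "CARD('a) = p ^ (p * l)"
    and g: "g = (\<lambda>x. x ^ (p ^ l))"
    and \<mu>: "\<mu> \<in> subfield_of_order (p ^ l) - {0}"
    and s: "\<And>i. i < p * l \<Longrightarrow> s i \<in> subfield_of_order (p ^ l)"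
    and sym: "\<And>i. i \<in> {1..p * l - 1} \<Longrightarrow> \<mu> * s i - s (p * l - i) ^ (p ^ i) * \<mu> ^ (p ^ i) = 0"
    and Q: "Q = (\<lambda>x. - abs_trace p (p * l) (\<mu> * x * poly (lin_poly p (p * l) s) x))"
    and G: "G = GammaL4\<lparr>carrier := {(E_mat a b c (poly (lin_poly p (p * l) s) c),
      prime_field_pow g (1 / 2 * Q c + abs_trace p (p * l) (\<mu> * b))) | a b c. True}\<rparr>"
    using assms(1) unfolding construction_C_def by blast
  interpret frobenius_field p 1 l g
    using p card g assms(2) by unfold_locales auto
  show ?thesis
    unfolding G ord_g using \<mu> s sym Q
    by (intro construction_C_bounds[where \<mu> = \<mu> and s = s and Q = Q]) (auto simp: in_subfield_iff)
qed

text \<open>As the group is given by generators, it suffices that these lie in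
  \<open>layer 0\<close>. The trace condition on \<open>b\<close> comes from \<open>\<mu>B\<close>,
  whereas \<open>\<mu>C\<close> yields \<open>Tr tC \<noteq> 0\<close> for the extra generator,
  whose automorphism part is \<open>g\<close>.\<close>

lemma construction_D_nilpotency_class:
  fixes g :: "'a::{field,finite} \<Rightarrow> 'a"
  assumes "construction_D l g G" "l > 1"
  shows "nilpotent_group G \<and>
    nilpotency_class G \<in> {2 * group.ord Aut_field g..3 * group.ord Aut_field g}"
proof -
  obtain \<mu>C tC \<mu>B s \<alpha> Q K where card: "CARD('a) = 3 ^ (9 * l)" and g: "g = (\<lambda>x. x ^ (3 ^ l))"
    and \<mu>C: "\<mu>C \<in> subfield_of_order (3 ^ l) - {0}" and tC: "abs_trace 3 (9 * l) (\<mu>C * tC) \<noteq> 0"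
    and \<mu>B: "\<mu>B \<in> subfield_of_order (3 ^ l) - {0}"
    and Q: "Q = (\<lambda>x. - abs_trace 3 (9 * l) (\<mu>B * x * poly (lin_poly 3 (9 * l) s) x))"
    and K: "K = {z. abs_trace 3 (9 * l) (\<mu>C * z) = 0}"
    and G: "G = GammaL4\<lparr>carrier := generate GammaL4
      ({(E_mat a b c (poly (lin_poly 3 (9 * l) s) c),
         prime_field_pow (g ^^ 3) (1 / 2 * Q c + abs_trace 3 (9 * l) (\<alpha> * c + \<mu>B * b))) | a b c. c \<in> K}
       \<union> {(E_mat 0 0 tC (poly (lin_poly 3 (9 * l) s) tC), g)})\<rparr>"
    using assms(1) unfolding construction_D_def by blast
  interpret frobenius_field 3 2 l g
    using card g assms(2) by unfold_locales auto
  interpret group "GammaL4 :: 'a semilin monoid"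
    by (rule group_GammaL4)
  define X where "X = {(E_mat a b c (poly (lin_poly 3 (9 * l) s) c),
         prime_field_pow (g ^^ 3) (1 / 2 * Q c + abs_trace 3 (9 * l) (\<alpha> * c + \<mu>B * b))) | a b c. c \<in> K}
       \<union> {(E_mat 0 0 tC (poly (lin_poly 3 (9 * l) s) tC), g)}"
  have X: "X \<subseteq> layer 0"
    unfolding X_def using prime_field_pow_in_layer_0[of _ _ _ _ 3] E_mat_in_layer_0[of _ _ _ _ 1] by auto
  have tr: "tr = abs_trace 3 (9 * l)"
    by simp
  have "subgroup (generate GammaL4 X) GammaL4"
    using X layer_carrier by (intro generate_is_subgroup) blast
  moreover have "generate GammaL4 X \<subseteq> layer 0"
    using X subgroup_layer by (rule generate_subgroup_incl)
  moreover have "\<mu>B \<noteq> 0" "g \<mu>B = \<mu>B"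
    using \<mu>B by (auto simp: in_subfield_iff)
  moreover have "(E_mat a b 0 0, id) \<in> generate GammaL4 X" if "tr (\<mu>B * b) = 0" for a b
  proof (rule generate.incl)
    have "(E_mat a b 0 (poly (lin_poly 3 (9 * l) s) 0),
         prime_field_pow (g ^^ 3) (1 / 2 * Q 0 + abs_trace 3 (9 * l) (\<alpha> * 0 + \<mu>B * b))) \<in> X"
    proof -
      have "0 \<in> K"
        using tr_0 unfolding tr K by simp
      then show ?thesis
        unfolding X_def by blast
    qed
    then show "(E_mat a b 0 0, id) \<in> X"
      using that tr_0 unfolding tr by (simp add: poly_lin_poly_0 Q prime_field_pow_0)
  qed
  moreover have "(E_mat 0 0 tC (poly (lin_poly 3 (9 * l) s) tC), g) \<in> generate GammaL4 X"
    by (rule generate.incl) (simp add: X_def)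
  moreover have "Tr tC \<noteq> 0"
    using \<mu>C tC by (intro Tr_neq_0I[of \<mu>C]) (auto simp: in_subfield_iff)
  ultimately show ?thesis
    unfolding G ord_g X_def[symmetric] by (rule nilpotency_class_bounds)
qed

theorem theorem8p8:
  fixes g :: "'a::{field,finite} \<Rightarrow> 'a"
    and G :: "'a semilin monoid"
    and p e l :: nat
  assumes "construction_B p l g G \<or> construction_C p l g G \<or> (p = 3 \<and> construction_D l g G)"
    and "p ^ e = group.ord Aut_field g"
    and "l > 1"
  shows "nilpotent_group G \<and> nilpotency_class G \<in> {2 * p ^ e..3 * p ^ e}"
  unfolding assms(2) using assms(1,3)
    construction_B_nilpotency_class construction_C_nilpotency_class construction_D_nilpotency_class
  by metis

end
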